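(* Let $\mathbb{F}_q$ be a finite field, let $k \ge 1$, and let $L(x_1, \dots, x_k) = a_1 x_1 + \cdots + a_k x_k$ be a linear form with $a_1, \dots, a_k \in \mathbb{F}_q \setminus\{0\}$. Let $\ell \ge 1$ and let $L'$ be the linear form in $k+\ell$ variables obtained by adding $\ell$ free variables to $L$, i.e. $L'(x_1, \dots, x_{k+\ell}) = a_1 x_1 + \cdots + a_k x_k + 0 x_{k+1} + \cdots + 0 x_{k+\ell}$. If $a_1, \dots, a_k$ can be partitioned into pairs each summing to zero, then the equation $L' = 0$ is Sidorenko and common; otherwise, the equation $L' = 0$ is not common and not Sidorenko.
   Context: Here $q$ is a prime power and $\mathbb{F}_q$ is the finite field with $q$ elements. A linear form $M(x_1,\dots,x_m) = c_1x_1+\cdots+c_mx_m$ with $c_1,\dots,c_m \in \mathbb{F}_q$ (coefficients may be zero) is evaluated on tuples $(x_1,\dots,x_m) \in (\mathbb{F}_q^n)^m$ of vectors, for any positive integer $n$. Solutions are ordered tuples, and coordinates may coincide. For such a form $M$ in $m$ variables, the equation $M=0$ is *Sidorenko* if for every $n$ and every $A \subseteq \mathbb{F}_q^n$, the number of solutions to $M(x_1,\dots,x_m)=0$ with $x_1,\dots,x_m \in A$ is at least $|A|^m/q^n$. The equation $M=0$ is *common* if for every $n$ and every coloring of $\mathbb{F}_q^n$ with two colors, the number of monochromatic solutions $(x_1,\dots,x_m) \in (\mathbb{F}_q^n)^m$ to $M(x_1,\dots,x_m)=0$ (i.e. solutions with all of $x_1,\dots,x_m$ of the same color, including variables with zero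 coefficient) is at least $2^{1-m} q^{n(m-1)}$. "$a_1,\dots,a_k$ can be partitioned into pairs each summing to zero" means that the index set $\{1,\dots,k\}$ can be partitioned into two-element sets $\{i,j\}$ (with $i \neq j$) such that $a_i + a_j = 0$ in $\mathbb{F}_q$ for each of them (in particular, $k$ is even). *)

theory Defs
  imports Complex_Main "HOL-Library.FuncSet" "HOL-Library.Cardinality" "HOL-Library.Disjoint_Sets"
begin

text \<open>
  The finite field is an arbitrary type \<open>'q\<close> of sort \<open>{field, finite}\<close>, with \<open>q = CARD('q)\<close>.
  Since the dimension \<open>n\<close> is quantified inside the definitions below, vectors are functions on
  \<open>{..<n}\<close> (extensional, hence finitely many). A linear form in \<open>m\<close> variables is given by \<open>m\<close> and
  coefficients \<open>c i\<close> for \<open>i < m\<close>; variables are indexed from \<open>0\<close>.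
\<close>

definition vecs :: "nat \<Rightarrow> (nat \<Rightarrow> 'q) set" where
  "vecs n = {..<n} \<rightarrow>\<^sub>E UNIV"

definition solutions ::
    "nat \<Rightarrow> nat \<Rightarrow> (nat \<Rightarrow> 'q::field) \<Rightarrow> (nat \<Rightarrow> 'q) set \<Rightarrow> (nat \<Rightarrow> nat \<Rightarrow> 'q) set" where
  "solutions n m c A = {x \<in> {..<m} \<rightarrow>\<^sub>E A. \<forall>j<n. (\<Sum>i<m. c i * x i j) = 0}"

definition sidorenko :: "nat \<Rightarrow> (nat \<Rightarrow> 'q::{field,finite}) \<Rightarrow> bool" where
  "sidorenko m c \<longleftrightarrow>
    (\<forall>n\<ge>1. \<forall>A\<subseteq>vecs n.
      real (card (solutions n m c A)) \<ge> real (card A) ^ m / real CARD('q) ^ n)"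

definition mono_solutions ::
    "nat \<Rightarrow> nat \<Rightarrow> (nat \<Rightarrow> 'q::field) \<Rightarrow> ((nat \<Rightarrow> 'q) \<Rightarrow> bool) \<Rightarrow> (nat \<Rightarrow> nat \<Rightarrow> 'q) set" where
  "mono_solutions n m c \<chi> = {x \<in> solutions n m c (vecs n). \<exists>b. \<forall>i<m. \<chi> (x i) = b}"

text \<open>Only the values of the colouring \<open>\<chi>\<close> on \<open>vecs n\<close> matter.\<close>

definition common :: "nat \<Rightarrow> (nat \<Rightarrow> 'q::{field,finite}) \<Rightarrow> bool" where
  "common m c \<longleftrightarrow>
    (\<forall>n\<ge>1. \<forall>\<chi> :: (nat \<Rightarrow> 'q) \<Rightarrow> bool.
      real (card (mono_solutions n m c \<chi>))
        \<ge> 2 powi (1 - int m) * real CARD('q) powi (int n * (int m - 1)))"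

definition zero_sum_pairing :: "nat \<Rightarrow> (nat \<Rightarrow> 'q::field) \<Rightarrow> bool" where
  "zero_sum_pairing k a \<longleftrightarrow>
    (\<exists>P. partition_on {..<k} P \<and>
         (\<forall>S\<in>P. \<exists>i j. i \<noteq> j \<and> S = {i, j} \<and> a i + a j = 0))"

definition add_free_variables :: "nat \<Rightarrow> (nat \<Rightarrow> 'q::field) \<Rightarrow> nat \<Rightarrow> 'q" where
  "add_free_variables k a = (\<lambda>i. if i < k then a i else 0)"

end

theory Submission
  imports Defs "HOL-Computational_Algebra.Primes"
begin

text \<open>
  Fix a nontrivial additive character of the field, and let \<open>F\<close> be the Fourier transform of a weight
  \<open>f\<close> on the vectors. Up to a factor, the number of solutions weighted by \<open>f\<close> is the sum over all
  frequencies \<open>\<xi>\<close> of \<open>F 0 ^ l * (\<Prod>i<k. F (a i * \<xi>))\<close> (lemma \<open>sum_solutions_eq_fourier\<close>): the \<open>l\<close> free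
  variables contribute \<open>F 0\<close>, the total weight.

  If the coefficients split into zero-sum pairs, then every product is a product of squares
  \<open>|F (a i * \<xi>)|\<^sup>2\<close>, because \<open>f\<close> is real. All frequencies contribute nonnegatively, and \<open>\<xi> = 0\<close> alone
  gives the Sidorenko bound (\<open>pairing_imp_sidorenko\<close>). A Sidorenko equation is common by convexity,
  applied to the two colour classes (\<open>sidorenko_imp_common\<close>); so it remains to show that the equation
  is not common if there is no pairing.

  In that case some \<open>c\<close> occurs among the coefficients with a multiplicity different from that of \<open>- c\<close>,
  or \<open>c = - c\<close> occurs an odd number of times (\<open>balanced_imp_pairing\<close>). Consider weights
  \<open>\<beta> + \<epsilon> * g\<close> whose nontrivial Fourier coefficients all have the same modulus and lie on the
  frequency line belonging to the first coordinate. The imbalance makes the contribution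
  of every nonzero frequency average to \<open>0\<close> over all choices of the phases, while the choice of all phases
  equal to \<open>1\<close> makes the total contribution positive; hence some choice makes it negative
  (\<open>phases_with_negative_sum\<close>). The weight and its complement then have fewer monochromatic
  solutions than the constant weight \<open>1/2\<close>: immediately with \<open>\<beta> = 1/2\<close> if \<open>k\<close> is even, and if \<open>k\<close> is odd
  because the free variables favour the denser class, so that \<open>\<beta>\<close> slightly above \<open>1/2\<close> works
  (\<open>bias_exists\<close>). This saves a fixed proportion of the solutions in every dimension \<open>n\<close>.

  Finally a random colouring with these probabilities has, in expectation, the same number of
  monochromatic solutions up to the error from solutions with repeated entries, which is negligible
  for large \<open>n\<close> (\<open>exists_colouring_le_weighted_count\<close>, \<open>card_noninjective_solutions\<close>).
\<close>

section \<open>Additive characters of a finite field\<close>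

lemma of_int_invertible:
  assumes "of_int d \<noteq> (0::'q::{field,finite})"
  shows "\<exists>u. of_int u * of_int d = (1::'q)"
proof -
  have "0 < CHAR('q)" by (rule finite_imp_CHAR_pos) simp
  then have p: "prime CHAR('q)" using prime_CHAR_semidom by blast
  have "\<not> int CHAR('q) dvd d" using assms of_int_eq_0_iff_char_dvd by blast
  then have "coprime (int CHAR('q)) d"
    using p by (simp add: prime_imp_coprime)
  then obtain x y where xy: "x * int CHAR('q) + y * d = 1"
    by (metis bezout_int coprime_imp_gcd_eq_1)
  have "(of_int (x * int CHAR('q) + y * d) :: 'q) = 1" by (simp only: xy of_int_1)
  then show ?thesis by auto
qed

locale additive_character =
  fixes e :: "'q::{field,finite} \<Rightarrow> complex"
  assumes add: "e (x + y) = e x * e y"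
    and norm_1: "norm (e x) = 1"
    and nontrivial: "\<exists>x. e x \<noteq> 1"

text \<open>
  The prime field is a direct summand of the additive group: an additive subgroup \<open>H\<close> that is maximal
  among those avoiding \<open>1\<close> is a complement of it. For if \<open>x \<notin> H\<close>, then \<open>H + \<int>x\<close> contains \<open>1\<close>, say
  \<open>1 = h + jx\<close>, and inverting the integer \<open>j\<close> modulo the characteristic \<open>p\<close> puts \<open>x\<close> into \<open>H + \<int>1\<close>.
  Sending \<open>h + j\<close> to \<open>cis (2 * pi * j / p)\<close> is then the desired character.
\<close>
lemma additive_character_exists: "\<exists>e :: 'q::{field,finite} \<Rightarrow> complex. additive_character e"
proof -
  let ?p = "CHAR('q)"
  have p0: "0 < ?p" by (rule finite_imp_CHAR_pos) simp
  let ?sub = "\<lambda>H::'q set. 0 \<in> H \<and> (\<forall>x\<in>H. \<forall>y\<in>H. x - y \<in> H) \<and> 1 \<notin> H"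
  have "?sub {0}" by simp
  moreover have "\<forall>H. ?sub H \<longrightarrow> card H < Suc CARD('q)"
    by (simp add: less_Suc_eq_le card_mono)
  ultimately have "\<exists>H. ?sub H \<and> (\<forall>H'. ?sub H' \<longrightarrow> card H' \<le> card H)"
    by (rule ex_has_greatest_nat)
  then obtain H where H: "?sub H" and Hmax: "\<And>H'. ?sub H' \<Longrightarrow> card H' \<le> card H" by blast
  have minus: "- x \<in> H" if "x \<in> H" for x using H that by (metis diff_0)
  have plus: "x + y \<in> H" if "x \<in> H" "y \<in> H" for x y
    using H that minus by (metis diff_minus_eq_add)
  have mult: "of_int j * x \<in> H" if "x \<in> H" for j x
  proof (induction j rule: int_induct[of _ 0])
    case base then show ?case using H by simp
  next
    case (step1 i) then show ?case using plus that by (simp add: distrib_right)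
  next
    case (step2 i) then show ?case using H that by (simp add: left_diff_distrib)
  qed
  have split: "\<exists>j::int. x - of_int j \<in> H" for x
  proof (cases "x \<in> H")
    case True then show ?thesis by (intro exI[of _ 0]) simp
  next
    case False
    let ?H' = "{h + of_int j * x | h j. h \<in> H}"
    have sub: "H \<subseteq> ?H'" by (force intro: exI[of _ "0::int"])
    moreover have "x \<in> ?H'" using H by (force intro: exI[of _ "0::'q"] exI[of _ "1::int"])
    ultimately have "card H < card ?H'" using False by (intro psubset_card_mono) auto
    moreover have "0 \<in> ?H'" using H sub by blast
    moreover have "s - t \<in> ?H'" if st: "s \<in> ?H'" "t \<in> ?H'" for s t
    proof -
      obtain h j h' j' where "s = h + of_int j * x" "t = h' + of_int j' * x" "h \<in> H" "h' \<in> H"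
        using st by blast
      then have "s - t = (h - h') + of_int (j - j') * x" "h - h' \<in> H"
        using H by (auto simp: algebra_simps)
      then show ?thesis by blast
    qed
    ultimately have "1 \<in> ?H'" using Hmax[of ?H'] by (meson leD)
    then obtain h j where hj: "1 = h + of_int j * x" "h \<in> H" by blast
    then have "of_int j \<noteq> (0::'q)" using H by auto
    then obtain u where u: "of_int u * of_int j = (1::'q)" using of_int_invertible by blast
    have "of_int u = of_int u * h + (of_int u * of_int j) * x"
      using hj(1) by (metis distrib_left mult.assoc mult.right_neutral)
    then have "x - of_int u = - (of_int u * h)" using u by (simp add: algebra_simps)
    then show ?thesis using mult[OF hj(2)] minus by metis
  qed
  define r where "r x = (SOME j::int. x - of_int j \<in> H)" for x
  have r: "x - of_int (r x) \<in> H" for x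
    unfolding r_def using someI_ex[OF split] by blast
  define e where "e x = cis (2 * pi * of_int (r x) / of_nat ?p)" for x
  \<comment> \<open>The value does not depend on the choice of \<open>j\<close>: two choices differ by an integer in \<open>H\<close>, and no
    integer that is invertible in the field lies in \<open>H\<close>.\<close>
  have e_eq: "e x = cis (2 * pi * of_int j / of_nat ?p)" if "x - of_int j \<in> H" for x j
  proof -
    have "(x - of_int j) - (x - of_int (r x)) \<in> H" using H r that by blast
    then have d: "of_int (r x - j) \<in> H" by simp
    have "of_int (r x - j) = (0::'q)"
      using of_int_invertible[of "r x - j"] mult[OF d] H by metis
    then obtain z where z: "r x - j = int ?p * z"
      using of_int_eq_0_iff_char_dvd[of "r x - j"] by (auto elim: dvdE)
    have "2 * pi * of_int (r x) / of_nat ?p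
        = 2 * pi * of_int j / of_nat ?p + 2 * pi * of_int (r x - j) / of_nat ?p"
      by (simp add: diff_divide_distrib right_diff_distrib)
    also have "\<dots> = 2 * pi * of_int j / of_nat ?p + 2 * pi * of_int z"
      using p0 unfolding z by simp
    finally have "e x = cis (2 * pi * of_int j / of_nat ?p) * cis (2 * pi * of_int z)"
      unfolding e_def by (simp only: cis_mult)
    then show ?thesis by simp
  qed
  have "additive_character e"
  proof
    fix x y
    have "(x - of_int (r x)) + (y - of_int (r y)) \<in> H" using plus r by blast
    then have "(x + y) - of_int (r x + r y) \<in> H" by (simp add: algebra_simps)
    from e_eq[OF this] show "e (x + y) = e x * e y"
      by (simp add: e_def cis_mult add_divide_distrib distrib_left)
  next
    show "norm (e x) = 1" for x by (simp add: e_def)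
  next
    have p2: "2 \<le> ?p"
      using p0 CHAR_not_1 by (metis One_nat_def Suc_leI le_neq_implies_less numeral_2_eq_2)
    have e1: "e 1 = cis (2 * pi / of_nat ?p)" using e_eq[of 1 1] H by simp
    have "cos (2 * pi / of_nat ?p) < cos 0"
      by (rule cos_monotone_0_pi) (use p2 in \<open>auto simp: field_simps\<close>)
    then have "e 1 \<noteq> 1" unfolding e1 by (auto simp: complex_eq_iff)
    then show "\<exists>x. e x \<noteq> 1" ..
  qed
  then show ?thesis by blast
qed

section \<open>Counting weighted solutions by Fourier analysis\<close>

lemma finite_vecs [simp]: "finite (vecs n :: (nat \<Rightarrow> 'q::finite) set)"
  by (simp add: vecs_def finite_PiE)

lemma card_vecs: "card (vecs n :: (nat \<Rightarrow> 'q::finite) set) = CARD('q) ^ n"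
  by (simp add: vecs_def card_PiE)

lemma finite_solutions [simp]: "finite A \<Longrightarrow> finite (solutions n m c A)"
  by (simp add: solutions_def finite_PiE)

context additive_character
begin

lemma e_0 [simp]: "e 0 = 1"
proof -
  have "e 0 * e 0 = e 0" using add[of 0 0] by simp
  moreover have "e 0 \<noteq> 0" using norm_1[of 0] by auto
  ultimately show ?thesis by simp
qed

lemma e_minus: "e (- x) = cnj (e x)"
proof -
  have 1: "e x * e (- x) = 1" using add[of x "- x"] by simp
  have "e x * cnj (e x) = 1" by (simp add: complex_norm_square[symmetric] norm_1)
  then have "e x * cnj (e x) = e x * e (- x)" using 1 by simp
  then show ?thesis using 1 by (metis mult_cancel_left mult_zero_left zero_neq_one)
qed

lemma e_sum: "e (sum f A) = (\<Prod>i\<in>A. e (f i))"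
  by (induction A rule: infinite_finite_induct) (auto simp: add)

lemma sum_e: "(\<Sum>x\<in>UNIV. e (s * x)) = (if s = 0 then of_nat CARD('q) else 0)"
proof (cases "s = 0")
  case False
  obtain y where y: "e y \<noteq> 1" using nontrivial by blast
  have "(\<Sum>x\<in>UNIV. e (s * x)) = (\<Sum>x\<in>UNIV. e (s * (x + y / s)))"
    by (rule sum.reindex_bij_witness[of _ "\<lambda>x. x + y / s" "\<lambda>x. x - y / s"]) auto
  also have "\<dots> = (\<Sum>x\<in>UNIV. e y * e (s * x))"
    using False by (intro sum.cong) (auto simp: distrib_left add)
  also have "\<dots> = e y * (\<Sum>x\<in>UNIV. e (s * x))" by (simp add: sum_distrib_left)
  finally have "(\<Sum>x\<in>UNIV. e (s * x)) * (1 - e y) = 0" by (simp add: algebra_simps)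
  then show ?thesis using y False by simp
qed simp

lemma sum_vecs_e:
  "(\<Sum>x\<in>vecs n. e (\<Sum>j<n. \<xi> j * x j)) = (if \<forall>j<n. \<xi> j = 0 then of_nat CARD('q) ^ n else 0)"
proof -
  have "(\<Sum>x\<in>vecs n. e (\<Sum>j<n. \<xi> j * x j)) = (\<Sum>x\<in>vecs n. \<Prod>j<n. e (\<xi> j * x j))"
    by (simp add: e_sum)
  also have "\<dots> = (\<Prod>j<n. \<Sum>y\<in>UNIV. e (\<xi> j * y))"
    unfolding vecs_def by (subst prod_sum_PiE) auto
  also have "\<dots> = (\<Prod>j<n. if \<xi> j = 0 then of_nat CARD('q) else 0)"
    by (simp add: sum_e)
  also have "\<dots> = (if \<forall>j<n. \<xi> j = 0 then of_nat CARD('q) ^ n else 0)"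
    by auto
  finally show ?thesis .
qed

definition fourier :: "nat \<Rightarrow> ((nat \<Rightarrow> 'q) \<Rightarrow> complex) \<Rightarrow> (nat \<Rightarrow> 'q) \<Rightarrow> complex" where
  "fourier n f \<xi> = (\<Sum>x\<in>vecs n. f x * e (\<Sum>j<n. \<xi> j * x j))"

text \<open>
  Orthogonality of characters detects the \<open>n\<close> scalar equations that define a solution. The weighted
  count of solutions becomes a sum over frequencies \<open>\<xi>\<close>, in which each variable contributes one
  independent factor; a variable with coefficient \<open>0\<close> contributes the total weight of \<open>f\<close>.
\<close>
lemma sum_solutions_eq_fourier:
  "(\<Sum>x\<in>solutions n m c (vecs n). \<Prod>i<m. f (x i))
     = (\<Sum>\<xi>\<in>vecs n. \<Prod>i<m. fourier n f (\<lambda>j. c i * \<xi> j)) / of_nat CARD('q) ^ n"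
proof -
  let ?V = "vecs n :: (nat \<Rightarrow> 'q) set" and ?X = "{..<m} \<rightarrow>\<^sub>E (vecs n :: (nat \<Rightarrow> 'q) set)"
  let ?q = "of_nat CARD('q) :: complex"
  have fin: "finite ?X" by (simp add: finite_PiE)
  have "(\<Sum>\<xi>\<in>?V. \<Prod>i<m. fourier n f (\<lambda>j. c i * \<xi> j))
      = (\<Sum>\<xi>\<in>?V. \<Sum>x\<in>?X. \<Prod>i<m. f (x i) * e (\<Sum>j<n. c i * \<xi> j * x i j))"
    unfolding fourier_def by (subst prod_sum_PiE) auto
  also have "\<dots> = (\<Sum>x\<in>?X. \<Sum>\<xi>\<in>?V. \<Prod>i<m. f (x i) * e (\<Sum>j<n. c i * \<xi> j * x i j))"
    by (rule sum.swap)
  also have "\<dots> = (\<Sum>x\<in>?X. (\<Prod>i<m. f (x i)) * (\<Sum>\<xi>\<in>?V. e (\<Sum>j<n. (\<Sum>i<m. c i * x i j) * \<xi> j)))"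
  proof (intro sum.cong refl)
    fix x
    have "(\<Sum>i<m. \<Sum>j<n. c i * \<xi> j * x i j) = (\<Sum>j<n. (\<Sum>i<m. c i * x i j) * \<xi> j)" for \<xi>
      by (subst sum.swap) (simp add: sum_distrib_right sum_distrib_left mult_ac)
    then show "(\<Sum>\<xi>\<in>?V. \<Prod>i<m. f (x i) * e (\<Sum>j<n. c i * \<xi> j * x i j))
      = (\<Prod>i<m. f (x i)) * (\<Sum>\<xi>\<in>?V. e (\<Sum>j<n. (\<Sum>i<m. c i * x i j) * \<xi> j))"
      by (simp add: prod.distrib e_sum[symmetric] sum_distrib_left)
  qed
  also have "\<dots> = (\<Sum>x\<in>?X. if \<forall>j<n. (\<Sum>i<m. c i * x i j) = 0 then (\<Prod>i<m. f (x i)) * ?q ^ n else 0)"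
    unfolding sum_vecs_e by (simp only: if_distrib[of "(*) _"] mult_zero_right)
  also have "\<dots> = (\<Sum>x\<in>solutions n m c ?V. (\<Prod>i<m. f (x i)) * ?q ^ n)"
    unfolding solutions_def using fin by (simp add: sum.inter_filter)
  finally show ?thesis by (simp add: sum_distrib_right[symmetric])
qed

lemma fourier_0: "(\<And>j. j < n \<Longrightarrow> \<xi> j = 0) \<Longrightarrow> fourier n f \<xi> = sum f (vecs n)"
  by (simp add: fourier_def)

lemma fourier_minus:
  assumes "\<And>x. f x \<in> \<real>"
  shows "fourier n f (\<lambda>j. - \<xi> j) = cnj (fourier n f \<xi>)"
  using assms by (simp add: fourier_def sum_negf e_minus Reals_cnj_iff)

end

section \<open>Sidorenko equations are common\<close>

lemma of_nat_card_solutions: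
  fixes c :: "nat \<Rightarrow> 'q::{field,finite}"
  shows "of_nat (card (solutions n m c {v \<in> vecs n. P v}))
     = (\<Sum>x\<in>solutions n m c (vecs n). \<Prod>i<m. of_bool (P (x i)) :: 'b::comm_semiring_1)"
proof -
  let ?S = "solutions n m c (vecs n)"
  have "solutions n m c {v \<in> vecs n. P v} = {x \<in> ?S. \<forall>i<m. P (x i)}"
    by (auto simp: solutions_def PiE_iff)
  moreover have "(\<Prod>i<m. of_bool (P (x i)) :: 'b) = of_bool (\<forall>i<m. P (x i))" for x
    by (induction m) (auto simp: less_Suc_eq)
  ultimately show ?thesis
    by (simp add: Collect_conj_eq Int_commute)
qed

lemma card_mono_solutions:
  fixes c :: "nat \<Rightarrow> 'q::{field,finite}"
  assumes "1 \<le> m"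
  shows "card (mono_solutions n m c \<chi>)
    = card (solutions n m c {v \<in> vecs n. \<chi> v}) + card (solutions n m c {v \<in> vecs n. \<not> \<chi> v})"
proof -
  let ?A = "solutions n m c {v \<in> vecs n. \<chi> v}" and ?B = "solutions n m c {v \<in> vecs n. \<not> \<chi> v}"
  have "mono_solutions n m c \<chi> = ?A \<union> ?B"
    by (auto simp: mono_solutions_def solutions_def PiE_iff)
  moreover have "?A \<inter> ?B = {}"
    using assms by (fastforce simp: solutions_def PiE_iff)
  ultimately show ?thesis by (simp add: card_Un_disjoint)
qed

lemma power_mean:
  assumes "0 \<le> a" and "0 \<le> (b::real)"
  shows "2 * ((a + b) / 2) ^ m \<le> a ^ m + b ^ m"
proof (induction m)
  case (Suc m)
  have "0 \<le> (a ^ m - b ^ m) * (a - b)"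
  proof (cases "a \<le> b")
    case True
    then have "a ^ m \<le> b ^ m" using assms by (intro power_mono) auto
    then show ?thesis using True by (intro mult_nonpos_nonpos) auto
  next
    case False
    then have "b ^ m \<le> a ^ m" using assms by (intro power_mono) auto
    then show ?thesis using False by simp
  qed
  then have "(a ^ m + b ^ m) * ((a + b) / 2) \<le> a ^ Suc m + b ^ Suc m"
    by (simp add: algebra_simps)
  moreover have "2 * ((a + b) / 2) ^ m * ((a + b) / 2) \<le> (a ^ m + b ^ m) * ((a + b) / 2)"
    using Suc assms by (intro mult_right_mono) auto
  ultimately show ?case by (simp add: mult_ac)
qed simp

text \<open>
  The lower bound in the definition of commonness is what two colour classes of density \<open>1/2\<close>
  would contribute if both attained the Sidorenko bound.
\<close>
lemma common_bound_eq:
  assumes "1 \<le> m" "0 < (q::real)"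
  shows "2 powi (1 - int m) * q powi (int n * (int m - 1)) = 2 * (q ^ n / 2) ^ m / q ^ n"
proof -
  obtain r where m: "m = Suc r" using assms(1) by (cases m) auto
  have "2 powi (1 - int m) = 1 / (2::real) ^ r" by (simp add: m power_int_minus field_simps)
  moreover have "int n * (int m - 1) = int (n * r)" by (simp add: m)
  then have "q powi (int n * (int m - 1)) = q ^ (n * r)" by (simp only: power_int_of_nat)
  ultimately show ?thesis using assms(2) by (simp add: m power_divide power_mult)
qed

text \<open>
  Apply the Sidorenko bound to the two colour classes; by convexity the sum of the two bounds is
  smallest when the classes have equal size.
\<close>
lemma sidorenko_imp_common:
  fixes c :: "nat \<Rightarrow> 'q::{field,finite}"
  assumes "1 \<le> m" and "sidorenko m c"
  shows "common m c"
  unfolding common_def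
proof (intro allI impI)
  fix n :: nat and \<chi> :: "(nat \<Rightarrow> 'q) \<Rightarrow> bool"
  assume n: "1 \<le> n"
  let ?A = "{v \<in> vecs n. \<chi> v}" and ?B = "{v \<in> vecs n. \<not> \<chi> v}"
  let ?N = "real CARD('q) ^ n"
  have "card ?A + card ?B = card (?A \<union> ?B)" by (subst card_Un_disjoint) auto
  also have "?A \<union> ?B = vecs n" by auto
  finally have "real (card ?A) + real (card ?B) = ?N"
    by (simp add: card_vecs flip: of_nat_add)
  then have "2 * (?N / 2) ^ m \<le> real (card ?A) ^ m + real (card ?B) ^ m"
    using power_mean[of "real (card ?A)" "real (card ?B)" m] by simp
  then have "2 * (?N / 2) ^ m / ?N \<le> real (card ?A) ^ m / ?N + real (card ?B) ^ m / ?N"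
    unfolding add_divide_distrib[symmetric] by (rule divide_right_mono) simp
  also have "\<dots> \<le> real (card (solutions n m c ?A)) + real (card (solutions n m c ?B))"
    using assms(2) n unfolding sidorenko_def by (intro add_mono) auto
  finally show "2 powi (1 - int m) * real CARD('q) powi (int n * (int m - 1))
      \<le> real (card (mono_solutions n m c \<chi>))"
    using assms(1) by (simp add: common_bound_eq card_mono_solutions)
qed

section \<open>Zero-sum pairings make every frequency contribute nonnegatively\<close>

lemma prod_append:
  "(\<Prod>i<k + l. h i) = (\<Prod>i<k. h i) * (\<Prod>i\<in>{k..<k + l}. h i :: 'b::comm_monoid_mult)"
  for k l :: nat
  by (induction l) (auto simp: mult_ac)

lemma prod_partition_append:
  fixes h :: "nat \<Rightarrow> 'b::comm_monoid_mult"
  assumes "partition_on {..<k} P"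
  shows "(\<Prod>i<k + l. h i) = (\<Prod>S\<in>P. \<Prod>i\<in>S. h i) * (\<Prod>i\<in>{k..<k + l}. h i)"
proof -
  have "(\<Prod>i<k + l. h i) = (\<Prod>i<k. h i) * (\<Prod>i\<in>{k..<k + l}. h i)"
    by (rule prod_append)
  moreover have "(\<Prod>i\<in>\<Union>P. h i) = (\<Prod>S\<in>P. \<Prod>i\<in>S. h i)"
  proof (rule prod.Union_disjoint[unfolded comp_def])
    show "\<forall>S\<in>P. finite S"
    proof
      fix S assume "S \<in> P"
      then have "S \<subseteq> {..<k}" using partition_onD1[OF assms] by auto
      then show "finite S" by (rule finite_subset) simp
    qed
    show "\<forall>S\<in>P. \<forall>T\<in>P. S \<noteq> T \<longrightarrow> S \<inter> T = {}"
      using partition_onD2[OF assms] by (auto simp: disjoint_def)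
  qed
  ultimately show ?thesis by (simp only: partition_onD1[OF assms, symmetric])
qed

context additive_character
begin

text \<open>
  On the Fourier side a pair \<open>{i, j}\<close> with \<open>a i + a j = 0\<close> contributes \<open>|F(a i * \<xi>)|\<^sup>2\<close>, where \<open>F\<close> is
  the transform of the (real) indicator function of \<open>A\<close>, and each free variable contributes \<open>card A\<close>.
  So all frequencies contribute nonnegatively, and the frequency \<open>0\<close> alone gives the Sidorenko
  bound.
\<close>
lemma pairing_imp_sidorenko:
  fixes a :: "nat \<Rightarrow> 'q"
  assumes "zero_sum_pairing k a"
  shows "sidorenko (k + l) (add_free_variables k a)"
  unfolding sidorenko_def
proof (intro allI impI)
  fix n :: nat and A :: "(nat \<Rightarrow> 'q) set"
  assume A: "A \<subseteq> vecs n"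
  let ?V = "vecs n :: (nat \<Rightarrow> 'q) set" and ?c = "add_free_variables k a"
  let ?f = "\<lambda>v. of_bool (v \<in> A) :: complex"
  let ?G = "\<lambda>\<xi> i. fourier n ?f (\<lambda>j. ?c i * \<xi> j)"
  obtain P where P: "partition_on {..<k} P"
    and pairs: "\<And>S. S \<in> P \<Longrightarrow> \<exists>i j. i \<noteq> j \<and> S = {i, j} \<and> a i + a j = 0"
    using assms unfolding zero_sum_pairing_def by blast
  have sumf: "sum ?f ?V = of_nat (card A)"
    using A by (simp add: Int_absorb1)
  have pair: "(\<Prod>i\<in>S. ?G \<xi> i) = of_real (\<Prod>i\<in>S. norm (?G \<xi> i))" if "S \<in> P" for S \<xi>
  proof -
    from pairs[OF that] obtain i j where ij: "i \<noteq> j" "S = {i, j}" "a i + a j = 0" by blast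
    have "S \<subseteq> {..<k}" unfolding partition_onD1[OF P] using that by (rule Union_upper)
    then have "i < k" "j < k" unfolding ij(2) by simp_all
    then have "?c j = - ?c i"
      using minus_unique[OF ij(3)] by (simp add: add_free_variables_def)
    then have "?G \<xi> j = fourier n ?f (\<lambda>j. - (?c i * \<xi> j))" by (simp only: mult_minus_left)
    also have "\<dots> = cnj (?G \<xi> i)" by (rule fourier_minus) simp
    finally have G: "?G \<xi> j = cnj (?G \<xi> i)" .
    have "(\<Prod>i\<in>S. ?G \<xi> i) = ?G \<xi> i * cnj (?G \<xi> i)"
      using ij(1) unfolding ij(2) G[symmetric] by simp
    also have "\<dots> = of_real (norm (?G \<xi> i) * norm (?G \<xi> j))"
      unfolding G complex_mod_cnj by (simp only: complex_norm_square[symmetric] power2_eq_square)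
    also have "norm (?G \<xi> i) * norm (?G \<xi> j) = (\<Prod>i\<in>S. norm (?G \<xi> i))"
      using ij(1) unfolding ij(2) by simp
    finally show ?thesis .
  qed
  have real: "(\<Prod>i<k + l. ?G \<xi> i) = of_real (\<Prod>i<k + l. norm (?G \<xi> i))" for \<xi>
  proof -
    have free: "?G \<xi> i = of_real (norm (?G \<xi> i))" if "i \<in> {k..<k + l}" for i
    proof -
      have "?G \<xi> i = of_nat (card A)"
        unfolding sumf[symmetric] using that by (intro fourier_0) (simp add: add_free_variables_def)
      then show ?thesis by (simp only: norm_of_nat of_real_of_nat_eq)
    qed
    have "(\<Prod>i<k + l. ?G \<xi> i)
        = (\<Prod>S\<in>P. of_real (\<Prod>i\<in>S. norm (?G \<xi> i))) * (\<Prod>i\<in>{k..<k + l}. of_real (norm (?G \<xi> i)))"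
      unfolding prod_partition_append[OF P]
      by (intro arg_cong2[where f = "(*)"] prod.cong refl pair free)
    also have "\<dots> = of_real (\<Prod>i<k + l. norm (?G \<xi> i))"
      unfolding prod_partition_append[OF P] of_real_mult of_real_prod ..
    finally show ?thesis .
  qed
  let ?z = "\<lambda>j\<in>{..<n}. 0::'q"
  let ?r = "\<lambda>\<xi>. \<Prod>i<k + l. norm (?G \<xi> i)"
  have "{v \<in> ?V. v \<in> A} = A" using A by auto
  then have "complex_of_nat (card (solutions n (k + l) ?c A))
      = (\<Sum>x\<in>solutions n (k + l) ?c ?V. \<Prod>i<k + l. ?f (x i))"
    using of_nat_card_solutions[of n "k + l" ?c "\<lambda>v. v \<in> A", where ?'b = complex] by (simp only:)
  also have "\<dots> = (\<Sum>\<xi>\<in>?V. of_real (?r \<xi>)) / of_nat CARD('q) ^ n"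
    by (simp only: sum_solutions_eq_fourier[of ?f] real)
  also have "\<dots> = of_real ((\<Sum>\<xi>\<in>?V. ?r \<xi>) / real CARD('q) ^ n)" by simp
  finally have "complex_of_real (real (card (solutions n (k + l) ?c A)))
      = of_real ((\<Sum>\<xi>\<in>?V. ?r \<xi>) / real CARD('q) ^ n)"
    by (simp only: of_real_of_nat_eq)
  then have "real (card (solutions n (k + l) ?c A)) = (\<Sum>\<xi>\<in>?V. ?r \<xi>) / real CARD('q) ^ n"
    by (simp only: of_real_eq_iff)
  moreover have "?r ?z \<le> (\<Sum>\<xi>\<in>?V. ?r \<xi>)"
  proof (rule member_le_sum)
    show "?z \<in> ?V" by (simp only: vecs_def restrict_PiE_iff) simp
  qed (simp_all add: prod_nonneg)
  moreover have "?G ?z i = of_nat (card A)" for i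
    unfolding sumf[symmetric] by (rule fourier_0) simp
  then have "?r ?z = real (card A) ^ (k + l)"
    by (simp only: norm_of_nat prod_constant card_lessThan)
  ultimately show "real (card A) ^ (k + l) / real CARD('q) ^ n
      \<le> real (card (solutions n (k + l) ?c A))"
    by (metis divide_right_mono of_nat_0_le_iff zero_le_power)
qed

end

section \<open>Phases with a negative sum in the absence of a pairing\<close>

text \<open>
  Equal multiplicities of \<open>c\<close> and \<open>- c\<close> allow a greedy matching. Elements with \<open>c = - c\<close> (which are
  nonzero only in characteristic \<open>2\<close>) have to be matched among themselves, whence the parity condition.
\<close>
lemma balanced_imp_pairing:
  fixes a :: "nat \<Rightarrow> 'q::field"
  assumes "finite I"
    and "\<And>c. c \<noteq> - c \<Longrightarrow> card {i\<in>I. a i = c} = card {i\<in>I. a i = - c}"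
    and "\<And>c. c = - c \<Longrightarrow> even (card {i\<in>I. a i = c})"
  shows "\<exists>P. partition_on I P \<and> (\<forall>S\<in>P. \<exists>i j. i \<noteq> j \<and> S = {i, j} \<and> a i + a j = 0)"
  using assms
proof (induction I rule: finite_psubset_induct)
  case (psubset I)
  let ?N = "\<lambda>I c. card {i\<in>I. a i = c}"
  show ?case
  proof (cases "I = {}")
    case True
    then show ?thesis by (intro exI[of _ "{}"]) (simp add: partition_on_empty)
  next
    case False
    then obtain i where i: "i \<in> I" by blast
    have pos: "0 < ?N I (a i)" using i psubset.hyps by (auto simp: card_gt_0_iff)
    have "\<exists>j\<in>I. j \<noteq> i \<and> a j = - a i"
    proof (cases "a i = - a i")
      case True
      then have "even (?N I (a i))" by (rule psubset.prems(2))
      then have "1 < ?N I (a i)" using pos by (cases "?N I (a i) = 1") auto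
      then have "\<not> {x\<in>I. a x = a i} \<subseteq> {i}"
        using card_mono[of "{i}" "{x\<in>I. a x = a i}"] by auto
      then show ?thesis using True by auto
    next
      case False
      have "0 < ?N I (- a i)" using pos unfolding psubset.prems(1)[OF False] .
      then have "{x\<in>I. a x = - a i} \<noteq> {}" unfolding card_gt_0_iff by blast
      then obtain j where j: "j \<in> I" "a j = - a i" by blast
      then have "j \<noteq> i" using False by auto
      then show ?thesis using j by blast
    qed
    then obtain j where j: "j \<in> I" "j \<noteq> i" "a j = - a i" by blast
    define J where "J = I - {i, j}"
    have J: "J \<subset> I" using i by (auto simp: J_def)
    have finJ: "finite J" using psubset.hyps by (simp add: J_def)
    have N_sum: "?N K c = (\<Sum>x\<in>K. of_bool (a x = c))" if "finite K" for K c
      using that by (simp add: Int_def)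
    have count: "?N I c = ?N J c + of_bool (a i = c) + of_bool (- a i = c)" for c
    proof -
      have "I = insert i (insert j J)" "i \<notin> insert j J" "j \<notin> J"
        using i j(1,2) by (auto simp: J_def)
      then have "(\<Sum>x\<in>I. of_bool (a x = c))
          = of_bool (a i = c) + (of_bool (a j = c) + (\<Sum>x\<in>J. of_bool (a x = c)) :: nat)"
        using finJ by (simp del: sum_of_bool_eq)
      then show ?thesis
        unfolding N_sum[OF psubset.hyps] N_sum[OF finJ] j(3) by (simp only: add_ac)
    qed
    have "\<exists>P. partition_on J P \<and> (\<forall>S\<in>P. \<exists>i j. i \<noteq> j \<and> S = {i, j} \<and> a i + a j = 0)"
    proof (rule psubset.IH[OF J])
      fix c :: 'q
      show "?N J c = ?N J (- c)" if "c \<noteq> - c"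
      proof -
        have "(- a i = c) = (a i = - c)" "(- a i = - c) = (a i = c)" by auto
        then show ?thesis using psubset.prems(1)[OF that] unfolding count[of c] count[of "- c"]
          by simp
      qed
      show "even (?N J c)" if "c = - c"
      proof -
        have "(- a i = c) = (a i = c)" using that by (metis minus_minus)
        then show ?thesis using psubset.prems(2)[OF that] unfolding count[of c] by auto
      qed
    qed
    then obtain P where P: "partition_on J P"
      "\<forall>S\<in>P. \<exists>i j. i \<noteq> j \<and> S = {i, j} \<and> a i + a j = 0" by blast
    have "partition_on I (insert {i, j} P)"
    proof (subst partition_on_insert)
      show "disjnt {i, j} (\<Union>P)"
        unfolding partition_onD1[OF P(1), symmetric] J_def disjnt_def by blast
      show "partition_on (I - {i, j}) P \<and> {i, j} \<subseteq> I \<and> {i, j} \<noteq> {}"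
        using P(1) i j by (simp add: J_def)
    qed
    moreover have "\<exists>x y. x \<noteq> y \<and> {i, j} = {x, y} \<and> a x + a y = 0"
      using j(2,3) by (intro exI[of _ i] exI[of _ j]) simp
    ultimately show ?thesis using P(2) by (intro exI[of _ "insert {i, j} P"]) simp
  qed
qed

lemma prod_if_eq_power:
  "finite I \<Longrightarrow> (\<Prod>i\<in>I. if P i then z else 1) = (z::'b::comm_monoid_mult) ^ card {i\<in>I. P i}"
  by (simp add: prod.If_cases Int_def)

text \<open>
  The exponent \<open>N\<close> is even so that \<open>-1\<close> is an \<open>N\<close>-th root of unity, which settles the case
  \<open>c = - c\<close>. It exceeds \<open>k\<close> so that distinct multiplicities, being at most \<open>k\<close>, give distinct powers
  of a primitive \<open>N\<close>-th root of unity.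
\<close>
lemma unbalanced_witness:
  fixes a :: "nat \<Rightarrow> 'q::field" and k :: nat
  defines "N \<equiv> 2 * (k + 1)" and "cnt \<equiv> \<lambda>c. card {i\<in>{..<k}. a i = c}"
  assumes "c \<noteq> - c \<and> cnt c \<noteq> cnt (- c) \<or> c = - c \<and> odd (cnt c)"
  shows "\<exists>u::'q \<Rightarrow> complex. (\<forall>s. u s ^ N = 1) \<and> (\<forall>s. u (- s) = cnj (u s)) \<and> (\<Prod>i<k. u (a i)) \<noteq> 1"
proof (cases "c = - c")
  case True
  define u where "u s = (if s = c then - 1 else 1 :: complex)" for s
  have "(- s = c) = (s = c)" for s using True by (metis minus_minus)
  then have "u (- s) = cnj (u s)" for s by (simp add: u_def)
  moreover have "u s ^ N = 1" for s by (simp add: u_def N_def)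
  moreover have "(\<Prod>i<k. u (a i)) = (- 1) ^ cnt c"
    unfolding u_def cnt_def by (rule prod_if_eq_power) simp
  then have "(\<Prod>i<k. u (a i)) \<noteq> 1" using True assms(3) by simp
  ultimately show ?thesis by blast
next
  case False
  define w where "w = cis (2 * pi * real 1 / real N)"
  define u where "u s = (if s = c then w else 1) * (if s = - c then cnj w else 1)" for s
  have N: "0 < N" by (simp add: N_def)
  have cnt_less: "cnt b < N" for b
  proof -
    have "cnt b \<le> card {..<k}" unfolding cnt_def by (rule card_mono) auto
    then show ?thesis by (simp add: N_def)
  qed
  have wpow: "w ^ n = cis (2 * pi * real n / real N)" for n
    unfolding w_def Complex.DeMoivre by (simp add: mult_ac)
  have wN: "w ^ N = 1" using N by (simp add: wpow)
  have ww: "w * cnj w = 1" unfolding w_def by (simp add: cis_cnj cis_mult)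
  have "u (- s) = cnj (u s)" for s
  proof -
    have "(- s = c) = (s = - c)" by auto
    moreover have "(- s = - c) = (s = c)" by auto
    ultimately show ?thesis by (simp add: u_def mult.commute)
  qed
  moreover have "u s ^ N = 1" for s
    using wN by (simp add: u_def power_mult_distrib flip: complex_cnj_power)
  moreover have prod: "(\<Prod>i<k. u (a i)) = w ^ cnt c * cnj w ^ cnt (- c)"
    unfolding u_def cnt_def prod.distrib by (simp add: prod_if_eq_power)
  have "(\<Prod>i<k. u (a i)) \<noteq> 1"
  proof
    assume "(\<Prod>i<k. u (a i)) = 1"
    then have "w ^ cnt c * cnj w ^ cnt (- c) * w ^ cnt (- c) = w ^ cnt (- c)"
      by (simp only: prod mult_1_left)
    moreover have "cnj w ^ cnt (- c) * w ^ cnt (- c) = 1"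
      using ww by (simp add: mult.commute flip: power_mult_distrib)
    ultimately have "w ^ cnt c = w ^ cnt (- c)" by (simp only: mult.assoc mult_1_right)
    moreover have "inj_on (\<lambda>n. w ^ n) {..<N}"
      using bij_betw_roots_unity[OF N] unfolding bij_betw_def wpow by blast
    ultimately have "cnt c = cnt (- c)" using cnt_less by (simp add: inj_on_def)
    then show False using False assms(3) by blast
  qed
  ultimately show ?thesis by blast
qed

text \<open>
  Average over the finite group \<open>U\<close> of all phase functions \<open>u\<close> with values in the \<open>N\<close>-th roots of unity
  and \<open>u (- s) = cnj (u s)\<close>. Each product \<open>\<Prod>i<k. u (a i * t)\<close> is a character of \<open>U\<close>, and the dilate of
  \<open>u0\<close> by \<open>t\<close> shows that it is nontrivial; so it averages to \<open>0\<close>. The constant phase \<open>1\<close> belongs to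
  \<open>U\<close> and has a positive sum, so some other phase function must have a negative one.
\<close>
lemma phases_with_negative_sum:
  fixes a :: "nat \<Rightarrow> 'q::{field,finite}"
  assumes "N > 0"
    and "\<forall>s. u0 s ^ N = 1" and "\<forall>s. u0 (- s) = cnj (u0 s)" and z: "(\<Prod>i<k. u0 (a i)) \<noteq> (1::complex)"
  shows "\<exists>u \<sigma>. (\<forall>s. norm (u s) = 1) \<and> (\<forall>s. u (- s) = cnj (u s)) \<and>
    \<sigma> < 0 \<and> (\<Sum>t\<in>- {0}. \<Prod>i<k. u (a i * t)) = complex_of_real \<sigma>"
proof -
  define U :: "('q \<Rightarrow> complex) set" where "U = {u. (\<forall>s. u s ^ N = 1) \<and> (\<forall>s. u (- s) = cnj (u s))}"
  define T where "T t u = (\<Prod>i<k. u (a i * t))" for t and u :: "'q \<Rightarrow> complex"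
  define S where "S u = (\<Sum>t\<in>- {0}. T t u)" for u
  have norm1: "norm (u s) = 1" if "u \<in> U" for u s
  proof -
    have "u s ^ N = 1" using that by (simp add: U_def)
    then show ?thesis using power_eq_1_iff[of "u s" N] \<open>N > 0\<close> by simp
  qed
  have inv: "u s * cnj (u s) = 1" if "u \<in> U" for u s
    by (simp only: complex_norm_square[symmetric] norm1[OF that]) simp
  have "finite U"
  proof (rule finite_subset)
    show "U \<subseteq> UNIV \<rightarrow>\<^sub>E {z. z ^ N = 1}" by (auto simp: U_def)
    show "finite (UNIV \<rightarrow>\<^sub>E {z. z ^ N = 1} :: ('q \<Rightarrow> complex) set)"
      using finite_roots_unity[of N] \<open>N > 0\<close> by (intro finite_PiE) auto
  qed
  have real: "S u = of_real (Re (S u))" if "u \<in> U" for u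
  proof -
    have "cnj (S u) = (\<Sum>t\<in>- {0}. T (- t) u)"
      using that by (simp add: S_def T_def U_def)
    also have "\<dots> = S u"
      unfolding S_def by (rule sum.reindex_bij_witness[of _ uminus uminus]) auto
    finally show ?thesis by (metis Reals_cnj_iff of_real_Re)
  qed
  have avg: "(\<Sum>u\<in>U. T t u) = 0" if t: "t \<noteq> 0" for t
  proof -
    define w where "w s = u0 (s / t)" for s
    have w: "w \<in> U" using assms(2,3) by (simp add: U_def w_def)
    have Tw: "T t w = (\<Prod>i<k. u0 (a i))" using t by (simp add: T_def w_def)
    have cancel: "w s * (cnj (w s) * x) = x" "cnj (w s) * (w s * x) = x" for s x
      using inv[OF w, of s] by (simp_all add: mult.assoc[symmetric] mult.commute[of "cnj (w s)"])
    have "(\<Sum>u\<in>U. T t u) = (\<Sum>u\<in>U. T t (\<lambda>s. w s * u s))"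
    proof (rule sum.reindex_bij_witness[of _ "\<lambda>u s. w s * u s" "\<lambda>u s. cnj (w s) * u s"])
      fix u assume u: "u \<in> U"
      show "(\<lambda>s. w s * u s) \<in> U" "(\<lambda>s. cnj (w s) * u s) \<in> U"
        using u w by (simp_all add: U_def power_mult_distrib flip: complex_cnj_power)
      show "(\<lambda>s. w s * (cnj (w s) * u s)) = u" "(\<lambda>s. cnj (w s) * (w s * u s)) = u"
        by (simp_all only: cancel)
      then show "T t (\<lambda>s. w s * (cnj (w s) * u s)) = T t u" by simp
    qed
    also have "\<dots> = T t w * (\<Sum>u\<in>U. T t u)"
      by (simp add: T_def prod.distrib sum_distrib_left)
    finally have "(1 - T t w) * (\<Sum>u\<in>U. T t u) = 0"
      by (simp add: left_diff_distrib)
    then show ?thesis using z Tw by simp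
  qed
  have "(\<Sum>u\<in>U. S u) = (\<Sum>t\<in>- {0}. \<Sum>u\<in>U. T t u)"
    unfolding S_def by (rule sum.swap)
  also have "\<dots> = 0" by (rule sum.neutral) (simp add: avg)
  finally have "(\<Sum>u\<in>U. Re (S u)) = 0" by (metis Re_sum zero_complex.sel(1))
  moreover have one: "(\<lambda>_. 1) \<in> U" by (simp add: U_def)
  have "(1::'q) \<in> - {0}" by simp
  then have "- {0::'q} \<noteq> {}" by blast
  then have "0 < Re (S (\<lambda>_. 1))" by (auto simp: S_def T_def card_gt_0_iff)
  ultimately have "\<not> (\<forall>u\<in>U. 0 \<le> Re (S u))"
    using sum_pos2[OF \<open>finite U\<close> one, of "\<lambda>u. Re (S u)"] by auto
  then have "\<exists>u\<in>U. Re (S u) < 0" by (simp add: not_le)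
  then obtain u where u: "u \<in> U" "Re (S u) < 0" by blast
  then show ?thesis
    using norm1[OF u(1)] real[OF u(1)]
    by (intro exI[of _ u] exI[of _ "Re (S u)"]) (simp add: U_def S_def T_def)
qed

section \<open>Fractional colourings with few monochromatic solutions\<close>

context additive_character
begin

lemma fourier_line:
  assumes "1 \<le> n"
  shows "fourier n (\<lambda>v. \<Sum>s\<in>UNIV. b s * e (s * v 0)) \<xi>
    = (if \<forall>j<n. j \<noteq> 0 \<longrightarrow> \<xi> j = 0 then of_nat CARD('q) ^ n * b (- \<xi> 0) else 0)"
proof -
  let ?q = "of_nat CARD('q) :: complex"
  let ?\<delta> = "\<lambda>s j. \<xi> j + (if j = 0 then s else 0)"
  have exponent: "s * v 0 + (\<Sum>j<n. \<xi> j * v j) = (\<Sum>j<n. ?\<delta> s j * v j)" for s and v :: "nat \<Rightarrow> 'q"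
  proof -
    have "(\<Sum>j<n. ?\<delta> s j * v j) = (\<Sum>j<n. \<xi> j * v j + (if j = 0 then s * v 0 else 0))"
      by (intro sum.cong) (auto simp: distrib_right)
    also have "\<dots> = (\<Sum>j<n. \<xi> j * v j) + s * v 0"
      using assms by (simp add: sum.distrib)
    finally show ?thesis by (simp add: add.commute)
  qed
  have "fourier n (\<lambda>v. \<Sum>s\<in>UNIV. b s * e (s * v 0)) \<xi>
      = (\<Sum>v\<in>vecs n. \<Sum>s\<in>UNIV. b s * e (\<Sum>j<n. ?\<delta> s j * v j))"
    unfolding fourier_def exponent[symmetric] by (simp add: add sum_distrib_right mult.assoc)
  also have "\<dots> = (\<Sum>s\<in>UNIV. b s * (\<Sum>v\<in>vecs n. e (\<Sum>j<n. ?\<delta> s j * v j)))"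
    by (subst sum.swap) (simp only: sum_distrib_left)
  also have "\<dots> = (\<Sum>s\<in>UNIV. if s = - \<xi> 0
      then (if \<forall>j<n. j \<noteq> 0 \<longrightarrow> \<xi> j = 0 then ?q ^ n * b (- \<xi> 0) else 0) else 0)"
  proof (intro sum.cong refl)
    fix s
    have "(\<forall>j<n. ?\<delta> s j = 0) \<longleftrightarrow> s = - \<xi> 0 \<and> (\<forall>j<n. j \<noteq> 0 \<longrightarrow> \<xi> j = 0)"
    proof
      assume *: "\<forall>j<n. ?\<delta> s j = 0"
      have "\<xi> 0 + s = 0" using *[rule_format, of 0] assms by simp
      moreover have "\<xi> j = 0" if "j < n" "j \<noteq> 0" for j using *[rule_format, of j] that by simp
      ultimately show "s = - \<xi> 0 \<and> (\<forall>j<n. j \<noteq> 0 \<longrightarrow> \<xi> j = 0)"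
        using minus_unique by blast
    qed auto
    then show "b s * (\<Sum>v\<in>vecs n. e (\<Sum>j<n. ?\<delta> s j * v j)) = (if s = - \<xi> 0
      then (if \<forall>j<n. j \<noteq> 0 \<longrightarrow> \<xi> j = 0 then ?q ^ n * b (- \<xi> 0) else 0) else 0)"
      unfolding sum_vecs_e by (simp only: if_distrib[of "(*) _"]) (auto simp: mult.commute)
  qed
  also have "\<dots> = (if \<forall>j<n. j \<noteq> 0 \<longrightarrow> \<xi> j = 0 then ?q ^ n * b (- \<xi> 0) else 0)"
    by (subst sum.delta) simp_all
  finally show ?thesis .
qed

lemma sum_vecs_line:
  fixes h :: "'q \<Rightarrow> complex"
  assumes "1 \<le> n"
  shows "(\<Sum>\<xi>\<in>vecs n. if \<forall>j<n. j \<noteq> 0 \<longrightarrow> \<xi> j = 0 then h (- \<xi> 0) else 0) = (\<Sum>t\<in>UNIV. h t)"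
proof -
  let ?L = "{\<xi>\<in>vecs n. \<forall>j<n. j \<noteq> 0 \<longrightarrow> \<xi> j = (0::'q)}"
  have "(\<Sum>\<xi>\<in>vecs n. if \<forall>j<n. j \<noteq> 0 \<longrightarrow> \<xi> j = 0 then h (- \<xi> 0) else 0) = (\<Sum>\<xi>\<in>?L. h (- \<xi> 0))"
    by (simp only: sum.inter_filter finite_vecs)
  also have "\<dots> = (\<Sum>t\<in>UNIV. h t)"
  proof (rule sum.reindex_bij_witness[of _ "\<lambda>t. \<lambda>j\<in>{..<n}. if j = 0 then - t else 0" "\<lambda>\<xi>. - \<xi> 0"])
    fix \<xi> assume \<xi>: "\<xi> \<in> ?L"
    then have ext: "\<xi> \<in> extensional {..<n}" by (auto simp: vecs_def PiE_def)
    show "(\<lambda>j\<in>{..<n}. if j = 0 then - (- \<xi> 0) else 0) = \<xi>"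
      by (rule extensionalityI[OF _ ext]) (use \<xi> in auto)
  next
    fix t :: 'q
    show "(\<lambda>j\<in>{..<n}. if j = 0 then - t else 0) \<in> ?L"
      by (simp only: vecs_def mem_Collect_eq restrict_PiE_iff) simp
  qed (use assms in auto)
  finally show ?thesis .
qed

text \<open>
  Here \<open>b\<close> is the prescribed Fourier transform of the weight, a function of the first coordinate.
  The count of solutions is then a sum over the one-dimensional frequency space \<open>'q\<close>, and depends on
  the dimension \<open>n\<close> only through the number of tuples of vectors.
\<close>
lemma sum_solutions_line:
  fixes a :: "nat \<Rightarrow> 'q"
  assumes "1 \<le> n" and "1 \<le> k" and nz: "\<And>i. i < k \<Longrightarrow> a i \<noteq> 0"
  shows "(\<Sum>x\<in>solutions n (k + l) (add_free_variables k a) (vecs n).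
      \<Prod>i<k + l. \<Sum>s\<in>UNIV. b s * e (s * x i 0))
    = (of_nat CARD('q) ^ n) ^ (k + l) / of_nat CARD('q) ^ n * (b 0 ^ l * (\<Sum>t\<in>UNIV. \<Prod>i<k. b (a i * t)))"
proof -
  let ?q = "of_nat CARD('q) :: complex" and ?c = "add_free_variables k a"
  let ?f = "\<lambda>v::nat \<Rightarrow> 'q. \<Sum>s\<in>UNIV. b s * e (s * v 0)"
  let ?line = "\<lambda>\<xi>::nat \<Rightarrow> 'q. \<forall>j<n. j \<noteq> 0 \<longrightarrow> \<xi> j = 0"
  have summand: "(\<Prod>i<k + l. fourier n ?f (\<lambda>j. ?c i * \<xi> j))
      = (if ?line \<xi> then (?q ^ n) ^ (k + l) * b 0 ^ l * (\<Prod>i<k. b (a i * - \<xi> 0)) else 0)" for \<xi>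
  proof -
    have bound: "fourier n ?f (\<lambda>j. ?c i * \<xi> j) = (if ?line \<xi> then ?q ^ n * b (a i * - \<xi> 0) else 0)"
      if "i \<in> {..<k}" for i
    proof -
      have c: "?c i = a i" "a i \<noteq> 0" using that nz[of i] by (simp_all add: add_free_variables_def)
      have line: "(\<forall>j<n. j \<noteq> 0 \<longrightarrow> ?c i * \<xi> j = 0) \<longleftrightarrow> ?line \<xi>"
        using c by simp
      show ?thesis unfolding fourier_line[OF assms(1)] line by (simp only: c(1) mult_minus_right)
    qed
    have free: "fourier n ?f (\<lambda>j. ?c i * \<xi> j) = ?q ^ n * b 0" if "i \<in> {k..<k + l}" for i
      using that unfolding fourier_line[OF assms(1)] by (simp add: add_free_variables_def)
    have "(\<Prod>i<k + l. fourier n ?f (\<lambda>j. ?c i * \<xi> j))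
        = (\<Prod>i<k. if ?line \<xi> then ?q ^ n * b (a i * - \<xi> 0) else 0) * (\<Prod>i\<in>{k..<k + l}. ?q ^ n * b 0)"
      unfolding prod_append by (intro arg_cong2[where f = "(*)"] prod.cong refl bound free)
    also have "\<dots> = (if ?line \<xi> then (?q ^ n) ^ (k + l) * b 0 ^ l * (\<Prod>i<k. b (a i * - \<xi> 0)) else 0)"
    proof (cases "?line \<xi>")
      case True
      show ?thesis
        unfolding if_P[OF True] by (simp add: prod.distrib power_mult_distrib power_add mult_ac)
    next
      case False
      show ?thesis unfolding if_not_P[OF False] using assms(2) by simp
    qed
    finally show ?thesis .
  qed
  have "(\<Sum>x\<in>solutions n (k + l) ?c (vecs n). \<Prod>i<k + l. ?f (x i))
      = (\<Sum>\<xi>\<in>vecs n. if ?line \<xi> then (?q ^ n) ^ (k + l) * b 0 ^ l * (\<Prod>i<k. b (a i * - \<xi> 0)) else 0) / ?q ^ n"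
    unfolding sum_solutions_eq_fourier[where f = ?f] summand ..
  also have "\<dots> = (\<Sum>t\<in>UNIV. (?q ^ n) ^ (k + l) * b 0 ^ l * (\<Prod>i<k. b (a i * t))) / ?q ^ n"
    unfolding sum_vecs_line[OF assms(1), of "\<lambda>t. (?q ^ n) ^ (k + l) * b 0 ^ l * (\<Prod>i<k. b (a i * t))"] ..
  finally show ?thesis
    by (simp only: sum_distrib_left[symmetric] mult.assoc times_divide_eq_left)
qed

text \<open>
  The weight has mean \<open>\<beta>\<close> and its nontrivial Fourier coefficients are \<open>\<epsilon> * u s\<close>. The frequency \<open>0\<close>
  contributes \<open>\<beta> ^ k\<close>, all others together \<open>\<epsilon> ^ k * \<sigma>\<close>, and each free variable a factor \<open>\<beta>\<close>.
\<close>
lemma sum_solutions_perturbed: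
  fixes a :: "nat \<Rightarrow> 'q" and u :: "'q \<Rightarrow> complex" and g :: "'q \<Rightarrow> real"
  assumes n: "1 \<le> n" and k: "1 \<le> k" and nz: "\<And>i. i < k \<Longrightarrow> a i \<noteq> 0"
    and g: "\<And>y. of_real (g y) = (\<Sum>s\<in>- {0}. u s * e (s * y))"
    and \<sigma>: "(\<Sum>t\<in>- {0}. \<Prod>i<k. u (a i * t)) = of_real \<sigma>"
  shows "(\<Sum>x\<in>solutions n (k + l) (add_free_variables k a) (vecs n). \<Prod>i<k + l. \<beta> + \<epsilon> * g (x i 0))
    = (real CARD('q) ^ n) ^ (k + l) / real CARD('q) ^ n * (\<beta> ^ l * (\<beta> ^ k + \<epsilon> ^ k * \<sigma>))"
    (is "?lhs = ?rhs")
proof -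
  define b :: "'q \<Rightarrow> complex" where "b s = (if s = 0 then of_real \<beta> else of_real \<epsilon> * u s)" for s
  have UNIV: "UNIV = insert 0 (- {0::'q})" by auto
  have f: "of_real (\<beta> + \<epsilon> * g y) = (\<Sum>s\<in>UNIV. b s * e (s * y))" for y
  proof -
    have "(\<Sum>s\<in>UNIV. b s * e (s * y)) = b 0 * e (0 * y) + (\<Sum>s\<in>- {0}. b s * e (s * y))"
      unfolding UNIV by (subst sum.insert) auto
    also have "(\<Sum>s\<in>- {0}. b s * e (s * y)) = (\<Sum>s\<in>- {0}. of_real \<epsilon> * (u s * e (s * y)))"
      by (intro sum.cong) (auto simp: b_def)
    finally show ?thesis by (simp add: b_def g sum_distrib_left)
  qed
  have "(\<Sum>t\<in>UNIV. \<Prod>i<k. b (a i * t)) = (\<Prod>i<k. b (a i * 0)) + (\<Sum>t\<in>- {0}. \<Prod>i<k. b (a i * t))"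
    unfolding UNIV by (subst sum.insert) auto
  also have "(\<Sum>t\<in>- {0}. \<Prod>i<k. b (a i * t)) = (\<Sum>t\<in>- {0}. of_real \<epsilon> ^ k * (\<Prod>i<k. u (a i * t)))"
  proof (intro sum.cong refl)
    fix t :: 'q assume "t \<in> - {0}"
    then have "(\<Prod>i<k. b (a i * t)) = (\<Prod>i<k. of_real \<epsilon> * u (a i * t))"
      using nz by (intro prod.cong) (auto simp: b_def)
    then show "(\<Prod>i<k. b (a i * t)) = of_real \<epsilon> ^ k * (\<Prod>i<k. u (a i * t))"
      by (simp add: prod.distrib)
  qed
  finally have S: "(\<Sum>t\<in>UNIV. \<Prod>i<k. b (a i * t)) = of_real (\<beta> ^ k + \<epsilon> ^ k * \<sigma>)"
    by (simp add: b_def \<sigma> flip: sum_distrib_left)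
  have "complex_of_real ?lhs = (\<Sum>x\<in>solutions n (k + l) (add_free_variables k a) (vecs n).
      \<Prod>i<k + l. \<Sum>s\<in>UNIV. b s * e (s * x i 0))"
    by (simp only: of_real_sum of_real_prod f)
  also have "\<dots> = (of_nat CARD('q) ^ n) ^ (k + l) / of_nat CARD('q) ^ n
      * (b 0 ^ l * (\<Sum>t\<in>UNIV. \<Prod>i<k. b (a i * t)))"
    by (rule sum_solutions_line[OF n k nz])
  also have "\<dots> = of_real ?rhs" unfolding S by (simp add: b_def)
  finally show ?thesis by (simp only: of_real_eq_iff)
qed

end

text \<open>
  With \<open>\<kappa> = \<epsilon> ^ k * \<sigma>\<close> the left-hand side is the normalised weight of monochromatic solutions for the
  densities \<open>\<beta> + \<epsilon> * g\<close> and its complement. For even \<open>k\<close> both classes gain from \<open>\<kappa>\<close> and \<open>\<beta> = 1/2\<close> works.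
  For odd \<open>k\<close> the two contributions of \<open>\<kappa>\<close> have opposite signs and cancel at \<open>\<beta> = 1/2\<close>; but the free
  variables weight them by \<open>\<beta> ^ l\<close> and \<open>(1 - \<beta>) ^ l\<close>, so moving \<open>\<beta>\<close> slightly above \<open>1/2\<close> gives a gain of
  first order in \<open>\<beta> - 1/2\<close> against a loss of second order. Without free variables there would be no such gain.
\<close>
lemma bias_exists:
  assumes "\<kappa> < (0::real)" and "1 \<le> l"
  shows "\<exists>\<beta>. 1/4 \<le> \<beta> \<and> \<beta> \<le> 3/4 \<and>
    \<beta> ^ m + (1 - \<beta>) ^ m + \<kappa> * (\<beta> ^ l + (-1) ^ k * (1 - \<beta>) ^ l) < 2 * (1/2) ^ m"
proof (cases "even k")
  case True
  have "\<kappa> * (2 * (1/2) ^ l) < 0" using assms(1) by (simp add: mult_neg_pos)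
  then show ?thesis using True by (intro exI[of _ "1/2"]) simp
next
  case False
  let ?h = "\<lambda>\<beta>. \<beta> ^ m + (1 - \<beta>) ^ m + \<kappa> * (\<beta> ^ l - (1 - \<beta>) ^ l)"
  have "(?h has_real_derivative \<kappa> * (2 * real l * (1/2) ^ (l - 1))) (at (1/2))"
    by (rule derivative_eq_intros refl | simp)+
  moreover have "\<kappa> * (2 * real l * (1/2) ^ (l - 1)) < 0"
    using assms by (intro mult_neg_pos) auto
  ultimately obtain d where d: "d > 0" "\<And>h. 0 < h \<Longrightarrow> h < d \<Longrightarrow> ?h (1/2 + h) < ?h (1/2)"
    using DERIV_neg_dec_right by blast
  define h where "h = min (d / 2) (1 / 4)"
  have "0 < h" "h < d" "h \<le> 1/4" using d(1) by (auto simp: h_def)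
  moreover from this have "?h (1/2 + h) < 2 * (1/2) ^ m" using d(2)[of h] by simp
  ultimately show ?thesis using False by (intro exI[of _ "1/2 + h"]) simp
qed

text \<open>
  A single fractional colouring \<open>F\<close> and a single constant \<open>\<rho>\<close> serve all dimensions \<open>n\<close> at once. This
  leaves a gap between \<open>\<rho>\<close> and the random value \<open>2 * (1 / 2) ^ (k + l)\<close> that does not shrink as \<open>n\<close> grows.
\<close>
lemma (in additive_character) exists_bad_function:
  fixes a :: "nat \<Rightarrow> 'q"
  assumes k: "1 \<le> k" and l: "1 \<le> l" and nz: "\<And>i. i < k \<Longrightarrow> a i \<noteq> 0"
    and "\<not> zero_sum_pairing k a"
  shows "\<exists>(F :: 'q \<Rightarrow> real) \<rho>. (\<forall>y. 0 \<le> F y \<and> F y \<le> 1) \<and> \<rho> < 2 * (1 / 2) ^ (k + l) \<and>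
    (\<forall>n\<ge>1. (\<Sum>x\<in>solutions n (k + l) (add_free_variables k a) (vecs n). \<Prod>i<k + l. F (x i 0))
      + (\<Sum>x\<in>solutions n (k + l) (add_free_variables k a) (vecs n). \<Prod>i<k + l. 1 - F (x i 0))
      = \<rho> * ((real CARD('q) ^ n) ^ (k + l) / real CARD('q) ^ n))"
proof -
  let ?q = "real CARD('q)"
  let ?N = "2 * (k + 1)"
  have q: "0 < ?q" by simp
  have "\<exists>c. c \<noteq> - c \<and> card {i\<in>{..<k}. a i = c} \<noteq> card {i\<in>{..<k}. a i = - c} \<or>
      c = - c \<and> odd (card {i\<in>{..<k}. a i = c})"
  proof (rule ccontr)
    assume balanced: "\<not> ?thesis"
    have "zero_sum_pairing k a" unfolding zero_sum_pairing_def
      by (rule balanced_imp_pairing) (use balanced in auto)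
    then show False using assms(4) by blast
  qed
  then obtain u0 :: "'q \<Rightarrow> complex" where u0: "\<forall>s. u0 s ^ ?N = 1" "\<forall>s. u0 (- s) = cnj (u0 s)"
    "(\<Prod>i<k. u0 (a i)) \<noteq> 1"
    using unbalanced_witness[of _ k a] by blast
  obtain u \<sigma> where u: "\<And>s. norm (u s) = 1" "\<And>s. u (- s) = cnj (u s)" and "\<sigma> < 0"
    and \<sigma>: "(\<Sum>t\<in>- {0}. \<Prod>i<k. u (a i * t)) = complex_of_real \<sigma>"
    using phases_with_negative_sum[OF _ u0] by auto
  define G where "G y = (\<Sum>s\<in>- {0}. u s * e (s * y))" for y
  define g where "g y = Re (G y)" for y
  have g: "complex_of_real (g y) = (\<Sum>s\<in>- {0}. u s * e (s * y))" for y
  proof -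
    have "cnj (G y) = (\<Sum>s\<in>- {0}. u (- s) * e (- s * y))"
      by (simp add: G_def u(2) e_minus)
    also have "\<dots> = G y"
      unfolding G_def by (rule sum.reindex_bij_witness[of _ uminus uminus]) auto
    finally have "of_real (g y) = G y" unfolding g_def by (metis Reals_cnj_iff of_real_Re)
    then show ?thesis by (simp only: G_def)
  qed
  have g_le: "\<bar>g y\<bar> \<le> ?q" for y
  proof -
    have "\<bar>g y\<bar> \<le> norm (G y)" unfolding g_def by (rule abs_Re_le_cmod)
    also have "\<dots> \<le> (\<Sum>s\<in>- {0}. norm (u s * e (s * y)))" unfolding G_def by (rule norm_sum)
    also have "\<dots> = real (card (- {0::'q}))" by (simp add: norm_mult u(1) norm_1)
    also have "\<dots> \<le> ?q" by (simp add: card_mono)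
    finally show ?thesis .
  qed
  \<comment> \<open>Small enough for \<open>\<beta> + \<epsilon> * g\<close> to stay in \<open>[0, 1]\<close> for every \<open>\<beta>\<close> between \<open>1/4\<close> and \<open>3/4\<close>.\<close>
  define \<epsilon> where "\<epsilon> = 1 / (4 * ?q)"
  have \<epsilon>: "\<bar>\<epsilon> * g y\<bar> \<le> 1 / 4" for y
  proof -
    have "\<bar>\<epsilon> * g y\<bar> = \<epsilon> * \<bar>g y\<bar>" using q by (simp add: \<epsilon>_def abs_mult)
    also have "\<dots> \<le> \<epsilon> * ?q" using q g_le by (intro mult_left_mono) (simp_all add: \<epsilon>_def)
    finally show ?thesis using q by (simp add: \<epsilon>_def)
  qed
  have "\<epsilon> ^ k * \<sigma> < 0" using q \<open>\<sigma> < 0\<close> by (intro mult_pos_neg) (simp_all add: \<epsilon>_def)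
  then obtain \<beta> where \<beta>: "1/4 \<le> \<beta>" "\<beta> \<le> 3/4"
    "\<beta> ^ (k + l) + (1 - \<beta>) ^ (k + l) + \<epsilon> ^ k * \<sigma> * (\<beta> ^ l + (-1) ^ k * (1 - \<beta>) ^ l) < 2 * (1/2) ^ (k + l)"
    using bias_exists[OF _ l, of "\<epsilon> ^ k * \<sigma>" "k + l" k] by blast
  define F where "F y = \<beta> + \<epsilon> * g y" for y
  define \<rho> where "\<rho> = \<beta> ^ l * (\<beta> ^ k + \<epsilon> ^ k * \<sigma>) + (1 - \<beta>) ^ l * ((1 - \<beta>) ^ k + (- \<epsilon>) ^ k * \<sigma>)"
  have "0 \<le> F y \<and> F y \<le> 1" for y using \<epsilon>[of y] \<beta>(1,2) unfolding F_def by linarith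
  moreover have "\<rho> < 2 * (1 / 2) ^ (k + l)"
  proof -
    have "(- \<epsilon>) ^ k = (-1) ^ k * \<epsilon> ^ k" by (rule power_minus)
    then show ?thesis using \<beta>(3) by (simp add: \<rho>_def algebra_simps power_add)
  qed
  moreover have "(\<Sum>x\<in>solutions n (k + l) (add_free_variables k a) (vecs n). \<Prod>i<k + l. F (x i 0))
      + (\<Sum>x\<in>solutions n (k + l) (add_free_variables k a) (vecs n). \<Prod>i<k + l. 1 - F (x i 0))
      = \<rho> * ((?q ^ n) ^ (k + l) / ?q ^ n)" if n: "1 \<le> n" for n
  proof -
    \<comment> \<open>The complementary density has the same shape, with \<open>\<beta>\<close> and \<open>\<epsilon>\<close> replaced by \<open>1 - \<beta>\<close> and \<open>- \<epsilon>\<close>.\<close>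
    have "1 - F y = (1 - \<beta>) + (- \<epsilon>) * g y" for y by (simp add: F_def)
    then show ?thesis
      unfolding \<rho>_def
      by (simp only: F_def sum_solutions_perturbed[OF n k nz g \<sigma>])
        (subst mult.commute[of "_ + _"], rule distrib_left[symmetric])
  qed
  ultimately show ?thesis by blast
qed

section \<open>From fractional colourings to colourings\<close>

text \<open>
  The product \<open>(\<Prod>v\<in>A. f v) * (\<Prod>v\<in>V - A. 1 - f v)\<close> is the probability of the random set \<open>A\<close> that
  contains each \<open>v\<close> independently with probability \<open>f v\<close>. Both identities come from expanding a
  product over \<open>V\<close> in which the unwanted alternative for each element of \<open>S\<close> is replaced by \<open>0\<close>.
\<close>
lemma sum_random_subset:
  fixes f :: "'v \<Rightarrow> real"
  assumes "finite V" and "S \<subseteq> V"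
  shows "(\<Sum>A\<in>Pow V. (\<Prod>v\<in>A. f v) * (\<Prod>v\<in>V - A. 1 - f v) * of_bool (S \<subseteq> A)) = (\<Prod>v\<in>S. f v)"
    and "(\<Sum>A\<in>Pow V. (\<Prod>v\<in>A. f v) * (\<Prod>v\<in>V - A. 1 - f v) * of_bool (S \<inter> A = {}))
      = (\<Prod>v\<in>S. 1 - f v)"
proof -
  have "(\<Prod>v\<in>V - A. if v \<in> S then 0 else 1 - f v) = (\<Prod>v\<in>V - A. 1 - f v) * of_bool (S \<subseteq> A)"
    if "A \<subseteq> V" for A
  proof (cases "S \<subseteq> A")
    case True
    then show ?thesis by (auto intro!: prod.cong)
  next
    case False
    then obtain v where "v \<in> S" "v \<in> V - A" using assms(2) by blast
    then have "(\<Prod>v\<in>V - A. if v \<in> S then 0 else 1 - f v) = 0"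
      using assms(1) by (intro prod_zero bexI[of _ v]) auto
    then show ?thesis using False by simp
  qed
  then have "(\<Sum>A\<in>Pow V. (\<Prod>v\<in>A. f v) * (\<Prod>v\<in>V - A. 1 - f v) * of_bool (S \<subseteq> A))
      = (\<Sum>A\<in>Pow V. (\<Prod>v\<in>A. f v) * (\<Prod>v\<in>V - A. if v \<in> S then 0 else 1 - f v))"
    by (intro sum.cong) (auto simp: mult_ac)
  also have "\<dots> = (\<Prod>v\<in>V. f v + (if v \<in> S then 0 else 1 - f v))"
    by (rule prod_add[OF assms(1), symmetric])
  also have "\<dots> = (\<Prod>v\<in>V. if v \<in> S then f v else 1)"
    by (intro prod.cong) auto
  also have "\<dots> = (\<Prod>v\<in>S. f v)"
    using assms by (subst prod.inter_restrict[symmetric]) (auto simp: Int_absorb1)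
  finally show "(\<Sum>A\<in>Pow V. (\<Prod>v\<in>A. f v) * (\<Prod>v\<in>V - A. 1 - f v) * of_bool (S \<subseteq> A))
      = (\<Prod>v\<in>S. f v)" .
next
  have "(\<Prod>v\<in>A. if v \<in> S then 0 else f v) = (\<Prod>v\<in>A. f v) * of_bool (S \<inter> A = {})"
    if "A \<subseteq> V" for A
  proof (cases "S \<inter> A = {}")
    case True
    then show ?thesis by (auto intro!: prod.cong)
  next
    case False
    then obtain v where "v \<in> S" "v \<in> A" by blast
    then have "(\<Prod>v\<in>A. if v \<in> S then 0 else f v) = 0"
      using finite_subset[OF that assms(1)] by (intro prod_zero bexI[of _ v]) auto
    then show ?thesis using False by simp
  qed
  then have "(\<Sum>A\<in>Pow V. (\<Prod>v\<in>A. f v) * (\<Prod>v\<in>V - A. 1 - f v) * of_bool (S \<inter> A = {}))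
      = (\<Sum>A\<in>Pow V. (\<Prod>v\<in>A. if v \<in> S then 0 else f v) * (\<Prod>v\<in>V - A. 1 - f v))"
    by (intro sum.cong) (auto simp: mult_ac)
  also have "\<dots> = (\<Prod>v\<in>V. (if v \<in> S then 0 else f v) + (1 - f v))"
    by (rule prod_add[OF assms(1), symmetric])
  also have "\<dots> = (\<Prod>v\<in>V. if v \<in> S then 1 - f v else 1)"
    by (intro prod.cong) auto
  also have "\<dots> = (\<Prod>v\<in>S. 1 - f v)"
    using assms by (subst prod.inter_restrict[symmetric]) (auto simp: Int_absorb1)
  finally show "(\<Sum>A\<in>Pow V. (\<Prod>v\<in>A. f v) * (\<Prod>v\<in>V - A. 1 - f v) * of_bool (S \<inter> A = {}))
      = (\<Prod>v\<in>S. 1 - f v)" .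
qed

text \<open>
  Some value of a random variable is at most its expectation, here for the random set of
  \<open>sum_random_subset\<close>.
\<close>
lemma exists_subset_le_expectation:
  fixes f :: "'v \<Rightarrow> real"
  assumes V: "finite V" and f: "\<And>v. v \<in> V \<Longrightarrow> 0 \<le> f v \<and> f v \<le> 1"
    and S: "\<And>x. x \<in> D \<Longrightarrow> S x \<subseteq> V"
  shows "\<exists>A\<subseteq>V. (\<Sum>x\<in>D. of_bool (S x \<subseteq> A) + of_bool (S x \<inter> A = {}))
    \<le> (\<Sum>x\<in>D. (\<Prod>v\<in>S x. f v) + (\<Prod>v\<in>S x. 1 - f v))"
proof (rule ccontr)
  let ?w = "\<lambda>A. (\<Prod>v\<in>A. f v) * (\<Prod>v\<in>V - A. 1 - f v)"
  let ?X = "\<lambda>A. \<Sum>x\<in>D. of_bool (S x \<subseteq> A) + of_bool (S x \<inter> A = {}) :: real"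
  let ?R = "\<Sum>x\<in>D. (\<Prod>v\<in>S x. f v) + (\<Prod>v\<in>S x. 1 - f v)"
  assume "\<not> ?thesis"
  then have gt: "?R < ?X A" if "A \<in> Pow V" for A using that by (meson PowD not_le)
  have w0: "0 \<le> ?w A" if "A \<in> Pow V" for A
    using f that by (intro mult_nonneg_nonneg prod_nonneg) auto
  have w1: "(\<Sum>A\<in>Pow V. ?w A) = 1"
    using sum_random_subset(1)[OF V, of "{}" f] by simp
  have "(\<Sum>A\<in>Pow V. ?w A * ?X A)
      = (\<Sum>x\<in>D. \<Sum>A\<in>Pow V. ?w A * of_bool (S x \<subseteq> A) + ?w A * of_bool (S x \<inter> A = {}))"
    by (subst sum.swap) (simp only: sum_distrib_left distrib_left)
  also have "\<dots> = ?R"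
    unfolding sum.distrib
    by (intro arg_cong2[where f = "(+)"] sum.cong refl sum_random_subset V S)
  finally have "(\<Sum>A\<in>Pow V. ?w A * (?X A - ?R)) = 0"
    by (simp only: right_diff_distrib sum_subtractf sum_distrib_right[symmetric] w1)
  moreover have "0 \<le> ?w A * (?X A - ?R)" if "A \<in> Pow V" for A
    by (rule mult_nonneg_nonneg[OF w0[OF that]]) (use gt[OF that] in simp)
  ultimately have zero: "\<forall>A\<in>Pow V. ?w A * (?X A - ?R) = 0"
    using V by (subst (asm) sum_nonneg_eq_0_iff) simp_all
  have "?w A = 0" if "A \<in> Pow V" for A
    using bspec[OF zero that] gt[OF that] by (simp only: mult_eq_0_iff) simp
  then have "(\<Sum>A\<in>Pow V. ?w A) = 0" by (rule sum.neutral[OF ballI])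
  then show False using w1 by (simp only: zero_neq_one)
qed

text \<open>
  The coefficients after identifying the variable \<open>j\<close> with the variable \<open>i\<close>; the entry at \<open>j\<close> is to be
  ignored.
\<close>
definition merge_coeff :: "(nat \<Rightarrow> 'q::field) \<Rightarrow> nat \<Rightarrow> nat \<Rightarrow> nat \<Rightarrow> 'q" where
  "merge_coeff c i j = c(i := c i + c j)"

text \<open>
  If identifying two variables leaves a nontrivial equation, then besides the identified variable
  one more is determined by the remaining ones.
\<close>
lemma card_solutions_two_equal:
  fixes c :: "nat \<Rightarrow> 'q::{field,finite}"
  assumes ij: "i < m" "j < m" "i \<noteq> j"
    and p: "p < m" "p \<noteq> j" "merge_coeff c i j p \<noteq> 0"
  shows "card {x\<in>solutions n m c (vecs n). x i = x j} \<le> (CARD('q) ^ n) ^ (m - 2)"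
proof -
  let ?c = "merge_coeff c i j"
  let ?X = "{x\<in>solutions n m c (vecs n). x i = x j}"
  let ?J = "{..<m} - {j, p}"
  have merged: "?c p * x p s = - (\<Sum>r\<in>?J. ?c r * x r s)" if x: "x \<in> ?X" and s: "s < n" for x s
  proof -
    have "0 = (\<Sum>r<m. c r * x r s)" using x s by (simp add: solutions_def)
    also have "\<dots> = c j * x j s + (\<Sum>r\<in>{..<m} - {j}. c r * x r s)"
      using ij(2) by (simp add: sum.remove)
    also have "\<dots> = c j * x j s + (c i * x i s + (\<Sum>r\<in>{..<m} - {j} - {i}. c r * x r s))"
      using ij by (subst sum.remove[of "{..<m} - {j}" i]) auto
    also have "(\<Sum>r\<in>{..<m} - {j} - {i}. c r * x r s) = (\<Sum>r\<in>{..<m} - {j} - {i}. ?c r * x r s)"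
      by (intro sum.cong) (auto simp: merge_coeff_def)
    also have "c j * x j s + (c i * x i s + (\<Sum>r\<in>{..<m} - {j} - {i}. ?c r * x r s))
        = ?c i * x i s + (\<Sum>r\<in>{..<m} - {j} - {i}. ?c r * x r s)"
      using x by (simp add: merge_coeff_def distrib_right)
    also have "\<dots> = (\<Sum>r\<in>{..<m} - {j}. ?c r * x r s)"
      using ij by (subst sum.remove[of "{..<m} - {j}" i]) auto
    also have "\<dots> = ?c p * x p s + (\<Sum>r\<in>{..<m} - {j} - {p}. ?c r * x r s)"
      using p by (subst sum.remove[of "{..<m} - {j}" p]) auto
    also have "{..<m} - {j} - {p} = ?J" by auto
    finally show ?thesis by (simp add: eq_neg_iff_add_eq_0)
  qed
  \<comment> \<open>Dropping the coordinates \<open>j\<close> and \<open>p\<close> loses nothing: \<open>x p\<close> is recovered from the merged equation,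
    and then \<open>x j = x i\<close>, where \<open>i\<close> may coincide with \<open>p\<close>.\<close>
  have "inj_on (\<lambda>x. restrict x ?J) ?X"
  proof (rule inj_onI)
    fix x y assume x: "x \<in> ?X" and y: "y \<in> ?X" and eq: "restrict x ?J = restrict y ?J"
    have J: "x r = y r" if "r \<in> ?J" for r using fun_cong[OF eq, of r] that by (simp only: restrict_apply')
    have ext: "x \<in> {..<m} \<rightarrow>\<^sub>E vecs n" "y \<in> {..<m} \<rightarrow>\<^sub>E vecs n"
      using x y by (auto simp: solutions_def)
    have "x p s = y p s" if "s < n" for s
    proof -
      have "(\<Sum>r\<in>?J. ?c r * x r s) = (\<Sum>r\<in>?J. ?c r * y r s)"
        by (intro sum.cong refl) (simp only: J)
      then have "?c p * x p s = ?c p * y p s" by (simp only: merged[OF x that] merged[OF y that])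
      then show ?thesis using p(3) by simp
    qed
    moreover have "x p \<in> vecs n" "y p \<in> vecs n" using ext p(1) by auto
    ultimately have xp: "x p = y p" by (auto simp: vecs_def intro: PiE_ext)
    have "x i = y i" using xp J[of i] ij by (cases "i = p") auto
    then have "x j = y j" using x y by simp
    then have "x r = y r" if "r < m" for r
      using xp J[of r] that by (cases "r = j"; cases "r = p") auto
    then show "x = y" using ext by (intro PiE_ext[OF ext]) auto
  qed
  moreover have "(\<lambda>x. restrict x ?J) ` ?X \<subseteq> ?J \<rightarrow>\<^sub>E vecs n"
    by (simp only: image_subset_iff restrict_PiE_iff) (auto simp: solutions_def)
  moreover have "finite (?J \<rightarrow>\<^sub>E (vecs n :: (nat \<Rightarrow> 'q) set))" by (intro finite_PiE) auto
  ultimately have "card ?X \<le> card (?J \<rightarrow>\<^sub>E (vecs n :: (nat \<Rightarrow> 'q) set))"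
    by (rule card_inj_on_le)
  also have "\<dots> = (CARD('q) ^ n) ^ card ?J" by (simp add: card_PiE card_vecs)
  also have "card ?J = m - 2" using ij p by (simp add: card_Diff_subset)
  finally show ?thesis .
qed

lemma card_noninjective_solutions:
  fixes c :: "nat \<Rightarrow> 'q::{field,finite}"
  assumes "\<And>i j. i < m \<Longrightarrow> j < m \<Longrightarrow> i \<noteq> j \<Longrightarrow> \<exists>p<m. p \<noteq> j \<and> merge_coeff c i j p \<noteq> 0"
  shows "card {x\<in>solutions n m c (vecs n). \<not> inj_on x {..<m}} \<le> m\<^sup>2 * (CARD('q) ^ n) ^ (m - 2)"
proof -
  let ?I = "{(i, j). i < m \<and> j < m \<and> i \<noteq> j}"
  let ?X = "\<lambda>(i, j). {x\<in>solutions n m c (vecs n). x i = x j}"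
  have sub: "?I \<subseteq> {..<m} \<times> {..<m}" by auto
  then have fin: "finite ?I" by (rule finite_subset) simp
  have "{x\<in>solutions n m c (vecs n). \<not> inj_on x {..<m}} \<subseteq> (\<Union>ij\<in>?I. ?X ij)"
    by (auto simp: inj_on_def)
  then have "card {x\<in>solutions n m c (vecs n). \<not> inj_on x {..<m}} \<le> card (\<Union>ij\<in>?I. ?X ij)"
    using fin by (intro card_mono) auto
  also have "\<dots> \<le> (\<Sum>ij\<in>?I. card (?X ij))" using fin by (rule card_UN_le)
  also have "\<dots> \<le> (\<Sum>ij\<in>?I. (CARD('q) ^ n) ^ (m - 2))"
  proof (rule sum_mono)
    fix ij assume "ij \<in> ?I"
    then obtain i j where "ij = (i, j)" "i < m" "j < m" "i \<noteq> j" by blast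
    then show "card (?X ij) \<le> (CARD('q) ^ n) ^ (m - 2)"
      using assms[of i j] card_solutions_two_equal[of i m j] by auto
  qed
  also have "\<dots> = card ?I * (CARD('q) ^ n) ^ (m - 2)" by simp
  also have "\<dots> \<le> card ({..<m} \<times> {..<m}) * (CARD('q) ^ n) ^ (m - 2)"
    using sub by (intro mult_right_mono card_mono) auto
  finally show ?thesis by (simp add: power2_eq_square)
qed

text \<open>
  Identifying two variables can only trivialise the equation if \<open>k = 2\<close> and \<open>a 0 + a 1 = 0\<close>, in which
  case \<open>{{0, 1}}\<close> is a zero-sum pairing.
\<close>
lemma merge_coeff_nonzero:
  fixes a :: "nat \<Rightarrow> 'q::field"
  assumes "1 \<le> k" and nz: "\<And>i. i < k \<Longrightarrow> a i \<noteq> 0" and "\<not> zero_sum_pairing k a"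
    and ij: "i < k + l" "j < k + l" "i \<noteq> j"
  shows "\<exists>p<k + l. p \<noteq> j \<and> merge_coeff (add_free_variables k a) i j p \<noteq> 0"
proof (rule ccontr)
  let ?c = "add_free_variables k a"
  assume "\<not> ?thesis"
  then have zero: "merge_coeff ?c i j p = 0" if "p < k + l" "p \<noteq> j" for p using that by blast
  have sum: "?c i + ?c j = 0" using zero[of i] ij by (simp add: merge_coeff_def)
  have sub: "p = i \<or> p = j" if "p < k" for p
    using zero[of p] nz[OF that] that by (auto simp: merge_coeff_def add_free_variables_def split: if_splits)
  have "i < k \<longleftrightarrow> j < k"
    using sum nz[of i] nz[of j] by (auto simp: add_free_variables_def split: if_splits)
  moreover have "i < k \<or> j < k" using sub[of 0] assms(1) by auto
  ultimately have lt: "i < k" "j < k" by auto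
  then have k: "{..<k} = {i, j}" using sub by auto
  have "a i + a j = 0" using sum lt by (simp add: add_free_variables_def)
  then have "zero_sum_pairing k a"
    unfolding zero_sum_pairing_def k using ij(3)
    by (intro exI[of _ "{{i, j}}"]) (auto simp: partition_on_space)
  then show False using assms(3) by blast
qed

text \<open>
  Colour randomly with probabilities \<open>f\<close>. A solution with distinct entries is monochromatic with
  probability \<open>(\<Prod>i<m. f (x i)) + (\<Prod>i<m. 1 - f (x i))\<close>, by independence; the other solutions are
  simply all counted.
\<close>
lemma exists_colouring_le_weighted_count:
  fixes c :: "nat \<Rightarrow> 'q::{field,finite}" and f :: "(nat \<Rightarrow> 'q) \<Rightarrow> real"
  assumes f: "\<And>v. 0 \<le> f v \<and> f v \<le> 1"
  shows "\<exists>\<chi>. real (card (mono_solutions n m c \<chi>))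
    \<le> (\<Sum>x\<in>solutions n m c (vecs n). \<Prod>i<m. f (x i))
      + (\<Sum>x\<in>solutions n m c (vecs n). \<Prod>i<m. 1 - f (x i))
      + real (card {x\<in>solutions n m c (vecs n). \<not> inj_on x {..<m}})"
proof -
  let ?S = "solutions n m c (vecs n)"
  let ?D = "{x\<in>?S. inj_on x {..<m}}" and ?E = "{x\<in>?S. \<not> inj_on x {..<m}}"
  have "x ` {..<m} \<subseteq> vecs n" if "x \<in> ?D" for x using that by (auto simp: solutions_def)
  then obtain A where A: "(\<Sum>x\<in>?D. of_bool (x ` {..<m} \<subseteq> A) + of_bool (x ` {..<m} \<inter> A = {}))
      \<le> (\<Sum>x\<in>?D. (\<Prod>v\<in>x ` {..<m}. f v) + (\<Prod>v\<in>x ` {..<m}. 1 - f v))"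
    using exists_subset_le_expectation[of "vecs n" f ?D "\<lambda>x. x ` {..<m}"] f by auto
  define \<chi> where "\<chi> v = (v \<in> A)" for v
  have fin: "finite ?D" "finite ?E" by simp_all
  let ?M = "{x\<in>?D. x ` {..<m} \<subseteq> A \<or> x ` {..<m} \<inter> A = {}}"
  have "mono_solutions n m c \<chi> \<subseteq> ?M \<union> ?E"
    by (auto simp: mono_solutions_def \<chi>_def)
  then have "card (mono_solutions n m c \<chi>) \<le> card (?M \<union> ?E)"
    by (rule card_mono[rotated]) (simp add: fin)
  also have "\<dots> \<le> card ?M + card ?E" by (rule card_Un_le)
  finally have "card (mono_solutions n m c \<chi>) \<le> card ?M + card ?E" .
  moreover have "real (card ?M) = (\<Sum>x\<in>?D. of_bool (x ` {..<m} \<subseteq> A \<or> x ` {..<m} \<inter> A = {}))"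
    by (subst sum_of_bool_eq) (simp_all only: fin Int_def mem_Collect_eq)
  moreover have "\<dots> \<le> (\<Sum>x\<in>?D. of_bool (x ` {..<m} \<subseteq> A) + of_bool (x ` {..<m} \<inter> A = {}) :: real)"
    by (intro sum_mono) auto
  moreover have "(\<Sum>x\<in>?D. (\<Prod>v\<in>x ` {..<m}. f v) + (\<Prod>v\<in>x ` {..<m}. 1 - f v))
      = (\<Sum>x\<in>?D. (\<Prod>i<m. f (x i)) + (\<Prod>i<m. 1 - f (x i)))"
    by (intro sum.cong refl) (simp add: prod.reindex)
  moreover have "\<dots> \<le> (\<Sum>x\<in>?S. (\<Prod>i<m. f (x i)) + (\<Prod>i<m. 1 - f (x i)))"
    using f by (intro sum_mono2) (auto intro!: add_nonneg_nonneg prod_nonneg)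
  ultimately have "real (card (mono_solutions n m c \<chi>))
    \<le> (\<Sum>x\<in>?S. (\<Prod>i<m. f (x i)) + (\<Prod>i<m. 1 - f (x i))) + real (card ?E)"
    using A by linarith
  then show ?thesis unfolding sum.distrib by blast
qed

text \<open>
  The gap provided by \<open>exists_bad_function\<close> is a fixed proportion of all solutions, whereas the
  solutions with repeated entries are a proportion of at most \<open>(k + l)\<^sup>2 / q ^ n\<close>. For large \<open>n\<close> the gap
  wins.
\<close>
lemma (in additive_character) not_pairing_imp_not_common:
  fixes a :: "nat \<Rightarrow> 'q"
  assumes k: "1 \<le> k" and l: "1 \<le> l" and nz: "\<And>i. i < k \<Longrightarrow> a i \<noteq> 0"
    and np: "\<not> zero_sum_pairing k a"
  shows "\<not> common (k + l) (add_free_variables k a)"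
proof
  let ?c = "add_free_variables k a" and ?m = "k + l" and ?q = "real CARD('q)"
  assume common: "common ?m ?c"
  obtain F :: "'q \<Rightarrow> real" and \<rho> where F: "\<And>y. 0 \<le> F y \<and> F y \<le> 1"
    and \<rho>: "\<rho> < 2 * (1 / 2) ^ ?m"
    and count: "\<And>n. 1 \<le> n \<Longrightarrow> (\<Sum>x\<in>solutions n ?m ?c (vecs n). \<Prod>i<?m. F (x i 0))
      + (\<Sum>x\<in>solutions n ?m ?c (vecs n). \<Prod>i<?m. 1 - F (x i 0)) = \<rho> * ((?q ^ n) ^ ?m / ?q ^ n)"
    using exists_bad_function[OF k l nz np] by blast
  have bound: "2 * (1 / 2) ^ ?m - \<rho> \<le> real (?m\<^sup>2) / ?q ^ n" if n: "1 \<le> n" for n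
  proof -
    let ?Q = "?q ^ n"
    have Q: "0 < ?Q" by simp
    obtain \<chi> where \<chi>: "real (card (mono_solutions n ?m ?c \<chi>))
      \<le> \<rho> * (?Q ^ ?m / ?Q) + real (card {x\<in>solutions n ?m ?c (vecs n). \<not> inj_on x {..<?m}})"
      using exists_colouring_le_weighted_count[of "\<lambda>v. F (v 0)" n ?m ?c] F count[OF n] by auto
    have "real (card {x\<in>solutions n ?m ?c (vecs n). \<not> inj_on x {..<?m}}) \<le> real (?m\<^sup>2 * (CARD('q) ^ n) ^ (?m - 2))"
      unfolding of_nat_le_iff
      by (intro card_noninjective_solutions merge_coeff_nonzero[OF k nz np])
    also have "\<dots> = real (?m\<^sup>2) / ?Q * (?Q ^ ?m / ?Q)"
    proof -
      obtain r where r: "?m = Suc (Suc r)" using k l by (metis One_nat_def Suc_le_D add_Suc add_Suc_right)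
      show ?thesis using Q unfolding r by simp
    qed
    finally have E: "real (card {x\<in>solutions n ?m ?c (vecs n). \<not> inj_on x {..<?m}})
      \<le> real (?m\<^sup>2) / ?Q * (?Q ^ ?m / ?Q)" .
    have "2 * (1 / 2) ^ ?m * (?Q ^ ?m / ?Q) = 2 * (?Q / 2) ^ ?m / ?Q"
      by (simp add: power_divide)
    also have "\<dots> = 2 powi (1 - int ?m) * ?q powi (int n * (int ?m - 1))"
      using k by (intro common_bound_eq[symmetric]) auto
    also have "\<dots> \<le> real (card (mono_solutions n ?m ?c \<chi>))"
      using common[unfolded common_def, rule_format, OF n, of \<chi>] .
    also have "\<dots> \<le> \<rho> * (?Q ^ ?m / ?Q) + real (?m\<^sup>2) / ?Q * (?Q ^ ?m / ?Q)"
      using \<chi> E by linarith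
    also have "\<dots> = (\<rho> + real (?m\<^sup>2) / ?Q) * (?Q ^ ?m / ?Q)" by (simp only: distrib_right)
    finally have "2 * (1 / 2) ^ ?m \<le> \<rho> + real (?m\<^sup>2) / ?Q"
      by (rule mult_right_le_imp_le) simp
    then show ?thesis by linarith
  qed
  define \<delta> where "\<delta> = 2 * (1 / 2) ^ ?m - \<rho>"
  have \<delta>: "0 < \<delta>" using \<rho> by (simp add: \<delta>_def)
  have "card {0, 1::'q} \<le> CARD('q)" by (rule card_mono) auto
  then have "1 < ?q" by simp
  then obtain n where "real (?m\<^sup>2) / \<delta> < ?q ^ n" using real_arch_pow by blast
  \<comment> \<open>The successor ensures that the dimension is positive.\<close>
  also have "\<dots> \<le> ?q ^ Suc n" using \<open>1 < ?q\<close> by (intro power_increasing) auto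
  finally have "real (?m\<^sup>2) < ?q ^ Suc n * \<delta>" by (simp only: pos_divide_less_eq[OF \<delta>])
  moreover have "0 < ?q ^ Suc n" by simp
  ultimately have "real (?m\<^sup>2) / ?q ^ Suc n < \<delta>"
    by (simp only: pos_divide_less_eq mult.commute)
  then show False using bound[of "Suc n"] by (simp add: \<delta>_def)
qed

section \<open>The dichotomy\<close>

theorem theorem1p5:
  fixes a :: "nat \<Rightarrow> 'q::{field,finite}" and k l :: nat
  assumes "k \<ge> 1" and "l \<ge> 1"
    and "\<And>i. i < k \<Longrightarrow> a i \<noteq> 0"
  shows "(zero_sum_pairing k a \<longrightarrow>
            sidorenko (k + l) (add_free_variables k a) \<and>
            common (k + l) (add_free_variables k a)) \<and>
         (\<not> zero_sum_pairing k a \<longrightarrow>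
            \<not> common (k + l) (add_free_variables k a) \<and>
            \<not> sidorenko (k + l) (add_free_variables k a))"
proof -
  obtain e :: "'q \<Rightarrow> complex" where "additive_character e"
    using additive_character_exists by blast
  then interpret additive_character e .
  have m: "1 \<le> k + l" using assms(1) by simp
  show ?thesis
  proof (intro conjI impI)
    assume "zero_sum_pairing k a"
    then show "sidorenko (k + l) (add_free_variables k a)" by (rule pairing_imp_sidorenko)
    then show "common (k + l) (add_free_variables k a)" by (rule sidorenko_imp_common[OF m])
  next
    assume "\<not> zero_sum_pairing k a"
    then show not_common: "\<not> common (k + l) (add_free_variables k a)"
      by (intro not_pairing_imp_not_common assms)
    then show "\<not> sidorenko (k + l) (add_free_variables k a)"
      using sidorenko_imp_common[OF m] by blast
  qed
qed

end
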